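(* Let $u\equiv1$ on $(0,1)^2$. For each of the four triangular meshes of $(0,1)^2$ called Mesh 1, Mesh 2, Mesh 3, Mesh 4 (described in the context) and $1\le q<\infty$, consider the constrained best approximation problem $$(P_q)\qquad u_h=\mathrm{arg\,min}\,\{\|u-v_h\|_{L^q((0,1)^2)} : v_h\in U_h,\ v_h(0,\cdot)=1,\ v_h(1,\cdot)=0\}.$$ The following statements hold. 1. The unique solution to $(P_1)$ on Mesh 1 is defined by $u_h(0.5,0.5)=\alpha$, where $\alpha$ satisfies $\alpha>1$ and $0=2\alpha^3-5\alpha+2$; hence $\alpha\approx1.3200$. 2. For $1<q<\infty$, the unique solution to $(P_q)$ on Mesh 1 is defined by $u_h(0.5,0.5)=\alpha$, where $\alpha$ satisfies $\alpha>1$ and $$0=(\alpha-1)^{q-1}\left[4\alpha^3q+4(1-q)\alpha^2+(q-6)\alpha+2\right]-\alpha(q+4)+2.$$ 3. If $q>1$, the solution to $(P_q)$ contains over- or undershoots on all four meshes. 4. There exists a solution to $(P_1)$ on Mesh 2 such that $u_h(0.5,1)=u_h(0.5,0.5)=1$ and $u_h(0.5,0)=\alpha$, where $\alpha$ satisfies $\alpha>1$ and $0=-3\alpha^3+8\alpha-4$; hence $\alpha\approx1.2723$. Furthermore, the function in $U_h$ on Mesh 2 satisfying the boundary constraints and $u_h(0.5,1)=u_h(0.5,0.5)=u_h(0.5,0)=1$ is not a solution to $(P_1)$. 5. On each of Mesh 3 and Mesh 4 there exists a solution to $(P_1)$ such that $u_h(0.5,1)=u_h(0.5,0.5)=u_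h(0.5,0)=1$.
   Context: For a given triangulation of $(0,1)^2$, $U_h$ denotes the space of all continuous functions on $[0,1]^2$ that are affine (polynomials of degree at most one) on each triangle. A solution to $(P_q)$ is any minimiser; it is also called an $L^q$-best approximation. The meshes are as follows. Mesh 1: the square $[0,1]^2$ is divided into four triangles by its two diagonals; the vertices are the four corners and $(0.5,0.5)$. Under the constraints the only free nodal value is $u_h(0.5,0.5)$. Meshes 2, 3, 4: the square is first divided into four congruent subsquares of side $0.5$ by the lines $x=0.5$ and $y=0.5$, and each subsquare is then divided into two triangles by one of its diagonals, so there are eight triangles and nine vertices $(i/2,j/2)$, $i,j\in\{0,1,2\}$. Under the constraints the free nodal values are $u_h(0.5,0)$, $u_h(0.5,0.5)$, $u_h(0.5,1)$. In Mesh 2 every subsquare is cut by the diagonal joining its bottom-left corner to its top-right corner. In Mesh 3 every subsquare is cut by the diagonal that passes through the centre $(0.5,0.5)$, i.e. the diagonals lie on the two diagonals of $[0,1]^2$. In Mesh 4 every subsquare is cut by the diagonal that does not pass through the centre $(0.5,0.5)$, i.e. the diagonals are the segments joining consecutive points among $(0.5,0),(1,0.5),(0.5,1),(0,0.5)$ in cyclic order. A function $u_h\in U_h$ satisfying the constraints contains no over- or undershoots if all its free nodal values (the value at $(0.5,0.5)$ for Mesh 1; the values at $(0.5,0),(0.5,0.5),(0.5,1)$ for Meshes 2-4) equal $1$; otherwise it contains over- or undershoots. *)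

theory Defs
  imports "HOL-Analysis.Analysis"
begin

definition unit_square :: "(real \<times> real) set" where
  "unit_square = {0..1} \<times> {0..1}"

definition open_unit_square :: "(real \<times> real) set" where
  "open_unit_square = {0<..<1} \<times> {0<..<1}"

text \<open>A mesh is the set of its triangles, each given by its set of three vertices;
  the triangle itself is the convex hull of that set.\<close>

type_synonym mesh = "(real \<times> real) set set"

definition mesh1 :: mesh where
  "mesh1 =
    {{(0, 0), (1, 0), (1/2, 1/2)},
     {(1, 0), (1, 1), (1/2, 1/2)},
     {(1, 1), (0, 1), (1/2, 1/2)},
     {(0, 1), (0, 0), (1/2, 1/2)}}"

text \<open>The two ways of cutting the square with side \<open>1/2\<close> and bottom-left corner \<open>(x, y)\<close>:
  \<open>cut_up\<close> uses the diagonal from bottom-left to top-right, \<open>cut_down\<close> the one from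
  top-left to bottom-right.\<close>

definition cut_up :: "real \<Rightarrow> real \<Rightarrow> mesh" where
  "cut_up x y =
    {{(x, y), (x + 1/2, y + 1/2), (x + 1/2, y)},
     {(x, y), (x + 1/2, y + 1/2), (x, y + 1/2)}}"

definition cut_down :: "real \<Rightarrow> real \<Rightarrow> mesh" where
  "cut_down x y =
    {{(x, y + 1/2), (x + 1/2, y), (x, y)},
     {(x, y + 1/2), (x + 1/2, y), (x + 1/2, y + 1/2)}}"

definition mesh2 :: mesh where
  "mesh2 = cut_up 0 0 \<union> cut_up (1/2) 0 \<union> cut_up 0 (1/2) \<union> cut_up (1/2) (1/2)"

definition mesh3 :: mesh where
  "mesh3 = cut_up 0 0 \<union> cut_down (1/2) 0 \<union> cut_down 0 (1/2) \<union> cut_up (1/2) (1/2)"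

definition mesh4 :: mesh where
  "mesh4 = cut_down 0 0 \<union> cut_up (1/2) 0 \<union> cut_up 0 (1/2) \<union> cut_down (1/2) (1/2)"

text \<open>The space \<open>U\<^sub>h\<close>. Functions on the closed unit square are represented as extensional
  functions (with value \<^const>\<open>undefined\<close> elsewhere), so that equality of functions is
  equality on the square.\<close>

definition U_h :: "mesh \<Rightarrow> (real \<times> real \<Rightarrow> real) set" where
  "U_h M = {v \<in> extensional unit_square. continuous_on unit_square v \<and>
     (\<forall>T\<in>M. \<exists>a b c. \<forall>(x, y)\<in>convex hull T. v (x, y) = a + b * x + c * y)}"

definition admissible :: "mesh \<Rightarrow> (real \<times> real \<Rightarrow> real) set" where
  "admissible M = {v \<in> U_h M. \<forall>y\<in>{0..1}. v (0, y) = 1 \<and> v (1, y) = 0}"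

definition Lq_norm :: "real \<Rightarrow> (real \<times> real \<Rightarrow> real) \<Rightarrow> real" where
  "Lq_norm q f = (LINT z:open_unit_square|lborel. \<bar>f z\<bar> powr q) powr (1 / q)"

text \<open>The set of all solutions of \<open>(P\<^sub>q)\<close> on the mesh \<open>M\<close> for the target function \<open>u\<close>.\<close>

definition solutions :: "(real \<times> real \<Rightarrow> real) \<Rightarrow> mesh \<Rightarrow> real \<Rightarrow> (real \<times> real \<Rightarrow> real) set" where
  "solutions u M q =
    {v. is_arg_min (\<lambda>w. Lq_norm q (\<lambda>z. u z - w z)) (\<lambda>w. w \<in> admissible M) v}"

text \<open>The constraints prescribe the nodal values at the vertices with abscissa \<open>0\<close> or \<open>1\<close>.\<close>

definition free_nodes :: "mesh \<Rightarrow> (real \<times> real) set" where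
  "free_nodes M = {p \<in> \<Union>M. fst p \<noteq> 0 \<and> fst p \<noteq> 1}"

lemma free_nodes_mesh1: "free_nodes mesh1 = {(1/2, 1/2)}"
  by (auto simp: free_nodes_def mesh1_def)

lemma free_nodes_mesh2: "free_nodes mesh2 = {(1/2, 0), (1/2, 1/2), (1/2, 1)}"
  by (auto simp: free_nodes_def mesh2_def cut_up_def)

lemma free_nodes_mesh3: "free_nodes mesh3 = {(1/2, 0), (1/2, 1/2), (1/2, 1)}"
  by (auto simp: free_nodes_def mesh3_def cut_up_def cut_down_def)

lemma free_nodes_mesh4: "free_nodes mesh4 = {(1/2, 0), (1/2, 1/2), (1/2, 1)}"
  by (auto simp: free_nodes_def mesh4_def cut_up_def cut_down_def)

definition over_or_undershoots :: "mesh \<Rightarrow> (real \<times> real \<Rightarrow> real) \<Rightarrow> bool" where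
  "over_or_undershoots M v \<longleftrightarrow> \<not> (\<forall>p\<in>free_nodes M. v p = 1)"

end

theory Submission imports Defs begin

text \<open>
  Every admissible function is \<open>1 - x\<close> plus a member \<open>\<phi> p\<close> of a finite-dimensional space of piecewise
  affine functions that vanish for \<open>x = 0\<close> and \<open>x = 1\<close>. Hence \<open>(P\<^sub>q)\<close> is the minimisation over \<open>p\<close> in
  \<open>\<real>\<close> or \<open>\<real>\<^sup>3\<close> of the convex cost \<open>\<integral> \<bar>x - \<phi> p\<bar>\<^sup>q\<close>. The cost grows at least linearly at infinity, so a
  minimiser exists (\<open>minimiser_exists\<close>), and for \<open>q > 1\<close> strict convexity makes it unique. For
  \<open>q = 1\<close> equality in the triangle inequality still shows that the errors of two minimisers never
  have opposite signs (\<open>minimisers_same_sign\<close>), which settles uniqueness on Mesh 1 and excludes the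
  function without overshoot on Mesh 2.

  A candidate with error \<open>e\<close> is optimal once there is a bounded \<open>w\<close> such that \<open>q w\<close> is a subgradient
  of \<open>\<bar>\<cdot>\<bar>\<^sup>q\<close> at \<open>e\<close> and \<open>w\<close> is orthogonal to all shape functions (\<open>minimiser_if_orthogonal\<close>). On Mesh 1
  only \<open>w = \<bar>e\<bar>\<^bsup>q-1\<^esup> sgn e\<close> is relevant. Fubini on the four triangles evaluates its integral against
  the single shape function, and the result is a nonzero multiple of the equation for \<open>\<alpha>\<close>
  (\<open>mesh1_orthogonality\<close>).

  On Meshes 2 to 4 the three free values equal to 1 leave no error in the left half of the square and
  the error \<open>2x - 1\<close> in the right half. Raising all three values to \<open>1 + t\<close> costs only \<open>O(t\<^sup>q)\<close> on the
  left but gains a multiple of \<open>t\<close> on the right, so for \<open>q > 1\<close> they are not optimal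
  (\<open>ridge_not_minimiser\<close>). For \<open>q = 1\<close> cost and gain have the same order. On Meshes 3 and 4 the
  reflection \<open>x \<mapsto> 1 - x\<close> preserves all shape functions, so the two balance and \<open>w = sgn (2x - 1)\<close> is a
  certificate of optimality. Mesh 2 lacks this symmetry. An optimal choice there keeps two of the
  values equal to 1; its error vanishes on three triangles, on which \<open>w\<close> may be any function with values
  between -1 and 1. This freedom achieves orthogonality to the two upper hats, and
  orthogonality to the remaining one is the cubic equation for \<open>\<alpha>\<close> (\<open>mesh2_minimiser\<close>).
\<close>

section \<open>Powers of the absolute value\<close>

text \<open>The derivative of \<open>\<bar>x\<bar>\<^sup>q / q\<close>. For \<open>q = 1\<close> it is \<open>sgn x\<close>, whose value 0 at the kink is a
  subgradient as well.\<close>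

definition pow_deriv :: "real \<Rightarrow> real \<Rightarrow> real" where
  "pow_deriv q x = \<bar>x\<bar> powr (q - 1) * sgn x"

text \<open>Mean value theorem: the slope \<open>q x\<^bsup>q-1\<^esup>\<close> is strictly increasing.\<close>

lemma powr_gt_tangent:
  fixes m x q :: real
  assumes "1 < q" "0 < m" "0 \<le> x" "x \<noteq> m"
  shows "m powr q + q * m powr (q - 1) * (x - m) < x powr q"
proof -
  have cont: "continuous_on {a..b} (\<lambda>x. x powr q)" if "0 \<le> a" for a b :: real
    using assms(1) that by (intro continuous_on_powr' continuous_intros) auto
  have deriv: "((\<lambda>x. x powr q) has_derivative (*) (q * t powr (q - 1))) (at t)" if "0 < t" for t :: real
    using has_real_derivative_powr[OF that, of q] by (simp add: has_field_derivative_def)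
  consider "m < x" | "x < m" using assms(4) by linarith
  then show ?thesis
  proof cases
    case 1
    obtain \<xi> where \<xi>: "m < \<xi>" "\<xi> < x" "x powr q - m powr q = (q * \<xi> powr (q - 1)) * (x - m)"
      by (rule mvt[OF 1 cont deriv]) (use \<open>0 < m\<close> in auto)
    have "m powr (q - 1) < \<xi> powr (q - 1)" using assms \<xi> by (intro powr_less_mono2) auto
    then have "q * m powr (q - 1) * (x - m) < q * \<xi> powr (q - 1) * (x - m)"
      using 1 assms by (intro mult_strict_right_mono mult_strict_left_mono) auto
    with \<xi> show ?thesis by linarith
  next
    case 2
    obtain \<xi> where \<xi>: "x < \<xi>" "\<xi> < m" "m powr q - x powr q = (q * \<xi> powr (q - 1)) * (m - x)"
      by (rule mvt[OF 2 cont deriv]) (use \<open>0 \<le> x\<close> in auto)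
    have "\<xi> powr (q - 1) < m powr (q - 1)" using assms \<xi> by (intro powr_less_mono2) auto
    then have "q * \<xi> powr (q - 1) * (m - x) < q * m powr (q - 1) * (m - x)"
      using 2 assms by (intro mult_strict_right_mono mult_strict_left_mono) auto
    with \<xi> show ?thesis by (simp add: algebra_simps)
  qed
qed

lemma pow_deriv_minus: "pow_deriv q (- x) = - pow_deriv q x"
  by (simp add: pow_deriv_def sgn_minus)

lemma abs_powr_gt_tangent:
  assumes "1 < q" "x \<noteq> m"
  shows "\<bar>m\<bar> powr q + q * pow_deriv q m * (x - m) < \<bar>x\<bar> powr q"
proof -
  have pos: "\<bar>m\<bar> powr q + q * pow_deriv q m * (x - m) < \<bar>x\<bar> powr q" if "0 < m" "x \<noteq> m" for x m
  proof (cases "0 \<le> x")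
    case True
    then show ?thesis using powr_gt_tangent[of q m x] assms(1) that by (simp add: pow_deriv_def)
  next
    case False
    have "q * m powr (q - 1) * (x - m) < q * m powr (q - 1) * (- x - m)"
      using False assms(1) that by (intro mult_strict_left_mono) auto
    moreover have "m powr q + q * m powr (q - 1) * (- x - m) \<le> (- x) powr q"
      using powr_gt_tangent[of q m "- x"] assms(1) that False by (cases "- x = m") auto
    ultimately show ?thesis using False that by (simp add: pow_deriv_def)
  qed
  consider "m = 0" | "m > 0" | "m < 0" by linarith
  then show ?thesis
  proof cases
    case 1
    then show ?thesis using assms by (simp add: pow_deriv_def)
  next
    case 2
    then show ?thesis using pos assms by blast
  next
    case 3
    then show ?thesis using pos[of "- m" "- x"] assms by (simp add: pow_deriv_minus algebra_simps)
  qed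
qed

lemma pow_deriv_1: "pow_deriv 1 x = sgn x"
  by (simp add: pow_deriv_def sgn_if)

lemma abs_powr_ge_tangent:
  assumes "1 \<le> q"
  shows "\<bar>m\<bar> powr q + q * pow_deriv q m * (x - m) \<le> \<bar>x\<bar> powr q"
proof (cases "q = 1")
  case True
  then show ?thesis by (auto simp: pow_deriv_1 sgn_if)
next
  case False
  then show ?thesis using abs_powr_gt_tangent[of q x m] assms by (cases "x = m") auto
qed

text \<open>The tangents at the midpoint cancel: the two increments from the midpoint are opposite.\<close>

lemma abs_powr_midpoint:
  fixes q x y :: real
  assumes "1 \<le> q"
  shows "2 * \<bar>(x + y) / 2\<bar> powr q \<le> \<bar>x\<bar> powr q + \<bar>y\<bar> powr q"
proof -
  define m where "m = (x + y) / 2"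
  have "q * pow_deriv q m * (x - m) + q * pow_deriv q m * (y - m) = 0"
    by (simp add: m_def field_simps)
  with abs_powr_ge_tangent[OF assms, of m x] abs_powr_ge_tangent[OF assms, of m y]
  show ?thesis by (simp add: m_def)
qed

lemma abs_powr_midpoint_strict:
  fixes q x y :: real
  assumes "1 < q" "x \<noteq> y"
  shows "2 * \<bar>(x + y) / 2\<bar> powr q < \<bar>x\<bar> powr q + \<bar>y\<bar> powr q"
proof -
  define m where "m = (x + y) / 2"
  have "x \<noteq> m" using assms by (simp add: m_def field_simps)
  have "q * pow_deriv q m * (x - m) + q * pow_deriv q m * (y - m) = 0"
    by (simp add: m_def field_simps)
  with abs_powr_gt_tangent[OF assms(1) \<open>x \<noteq> m\<close>] abs_powr_ge_tangent[of q m y] assms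
  show ?thesis by (simp add: m_def)
qed

lemma convex_on_abs_powr:
  assumes "1 \<le> q"
  shows "convex_on UNIV (\<lambda>x::real. \<bar>x\<bar> powr q)"
proof (rule convex_onI)
  fix t x y :: real
  assume t: "0 < t" "t < 1"
  define m where "m = (1 - t) * x + t * y"
  have "(1 - t) * (\<bar>m\<bar> powr q + q * pow_deriv q m * (x - m)) \<le> (1 - t) * \<bar>x\<bar> powr q"
    "t * (\<bar>m\<bar> powr q + q * pow_deriv q m * (y - m)) \<le> t * \<bar>y\<bar> powr q"
    using t abs_powr_ge_tangent[OF assms] by (intro mult_left_mono; simp)+
  moreover have "(1 - t) * (\<bar>m\<bar> powr q + q * pow_deriv q m * (x - m))
      + t * (\<bar>m\<bar> powr q + q * pow_deriv q m * (y - m)) = \<bar>m\<bar> powr q"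
    by (simp add: m_def algebra_simps)
  ultimately show "\<bar>(1 - t) *\<^sub>R x + t *\<^sub>R y\<bar> powr q \<le> (1 - t) * \<bar>x\<bar> powr q + t * \<bar>y\<bar> powr q"
    by (simp add: m_def)
qed auto

lemma continuous_on_abs_powr [continuous_intros]:
  assumes "continuous_on S f" "0 < q"
  shows "continuous_on S (\<lambda>x. \<bar>f x :: real\<bar> powr q)"
  using assms by (intro continuous_on_powr') (auto intro!: continuous_intros)

lemma abs_pow_deriv_le:
  assumes "1 \<le> q" "\<bar>x\<bar> \<le> B"
  shows "\<bar>pow_deriv q x\<bar> \<le> B powr (q - 1)"
proof -
  have "\<bar>pow_deriv q x\<bar> \<le> \<bar>x\<bar> powr (q - 1)"
    by (auto simp: pow_deriv_def abs_mult sgn_if)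
  also have "\<dots> \<le> B powr (q - 1)" using assms by (intro powr_mono2) auto
  finally show ?thesis .
qed

lemma borel_measurable_pow_deriv [measurable]: "pow_deriv q \<in> borel_measurable borel"
  unfolding pow_deriv_def[abs_def] by measurable

section \<open>Piecewise affine functions on a triangulation\<close>

definition affine_fun_on :: "(real \<times> real) set \<Rightarrow> (real \<times> real \<Rightarrow> real) \<Rightarrow> bool" where
  "affine_fun_on S f \<longleftrightarrow> (\<exists>a b c. \<forall>z\<in>S. f z = a + b * fst z + c * snd z)"

lemma affine_fun_onI:
  "(\<And>z. z \<in> S \<Longrightarrow> f z = a + b * fst z + c * snd z) \<Longrightarrow> affine_fun_on S f"
  unfolding affine_fun_on_def by blast

lemma affine_fun_on_const [intro]: "affine_fun_on S (\<lambda>z. k)"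
  by (rule affine_fun_onI[of _ _ k 0 0]) simp

lemma affine_fun_on_fst [intro]: "affine_fun_on S fst"
  by (rule affine_fun_onI[of _ _ 0 1 0]) simp

lemma affine_fun_on_snd [intro]: "affine_fun_on S snd"
  by (rule affine_fun_onI[of _ _ 0 0 1]) simp

lemma affine_fun_on_add [intro]:
  assumes "affine_fun_on S f" "affine_fun_on S g"
  shows "affine_fun_on S (\<lambda>z. f z + g z)"
proof -
  obtain a b c a' b' c' where
    "\<forall>z\<in>S. f z = a + b * fst z + c * snd z" "\<forall>z\<in>S. g z = a' + b' * fst z + c' * snd z"
    using assms unfolding affine_fun_on_def by blast
  then show ?thesis
    by (intro affine_fun_onI[of _ _ "a + a'" "b + b'" "c + c'"]) (simp add: algebra_simps)
qed

lemma affine_fun_on_mult_left [intro]: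
  assumes "affine_fun_on S f"
  shows "affine_fun_on S (\<lambda>z. k * f z)"
proof -
  obtain a b c where "\<forall>z\<in>S. f z = a + b * fst z + c * snd z"
    using assms unfolding affine_fun_on_def by blast
  then show ?thesis
    by (intro affine_fun_onI[of _ _ "k * a" "k * b" "k * c"]) (simp add: algebra_simps)
qed

lemma affine_fun_on_diff [intro]:
  assumes "affine_fun_on S f" "affine_fun_on S g"
  shows "affine_fun_on S (\<lambda>z. f z - g z)"
  using affine_fun_on_add[OF assms(1) affine_fun_on_mult_left[OF assms(2), of "-1"]] by simp

lemma affine_fun_on_cong:
  assumes "affine_fun_on S f" "\<And>z. z \<in> S \<Longrightarrow> g z = f z"
  shows "affine_fun_on S g"
  using assms unfolding affine_fun_on_def by metis

text \<open>A closed half-plane that contains the vertices contains their convex hull. Order and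
  equality of affine functions on a triangle can therefore be decided at its vertices.\<close>

lemma affine_fun_on_hull_le:
  assumes "affine_fun_on (convex hull T) f" "affine_fun_on (convex hull T) g"
    and "\<forall>z\<in>T. f z \<le> g z" "z \<in> convex hull T"
  shows "f z \<le> g z"
proof -
  have "affine_fun_on (convex hull T) (\<lambda>z. g z - f z)" using assms(1,2) by blast
  then obtain a b c where abc: "\<And>z. z \<in> convex hull T \<Longrightarrow> g z - f z = a + b * fst z + c * snd z"
    unfolding affine_fun_on_def by blast
  let ?H = "{z. (b, c) \<bullet> z \<ge> - a}"
  have "T \<subseteq> ?H"
  proof
    fix w assume "w \<in> T"
    then show "w \<in> ?H"
      using abc[of w] assms(3) hull_inc[of w T convex] by (auto simp: inner_prod_def)
  qed
  then have "convex hull T \<subseteq> ?H" by (rule hull_minimal) (rule convex_halfspace_ge)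
  then have "0 \<le> a + b * fst z + c * snd z"
    using assms(4) by (auto simp: inner_prod_def)
  with abc[OF assms(4)] show ?thesis by simp
qed

text \<open>Maxima and absolute values stay affine on a triangle whose vertices do not see
  a change of the order or the sign. This lets the explicit formulas for hat functions be checked
  triangle by triangle by evaluation at vertices alone.\<close>

lemma affine_fun_on_hull_max:
  assumes "affine_fun_on (convex hull T) f" "affine_fun_on (convex hull T) g"
    and "(\<forall>z\<in>T. f z \<le> g z) \<or> (\<forall>z\<in>T. g z \<le> f z)"
  shows "affine_fun_on (convex hull T) (\<lambda>z. max (f z) (g z))"
  using assms(3)
proof
  assume "\<forall>z\<in>T. f z \<le> g z"
  from affine_fun_on_hull_le[OF assms(1,2) this] show ?thesis
    by (intro affine_fun_on_cong[OF assms(2)]) (auto simp: max_def intro: antisym)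
next
  assume "\<forall>z\<in>T. g z \<le> f z"
  from affine_fun_on_hull_le[OF assms(2,1) this] show ?thesis
    by (intro affine_fun_on_cong[OF assms(1)]) (auto simp: max_def intro: antisym)
qed

lemma affine_fun_on_hull_abs:
  assumes "affine_fun_on (convex hull T) f" "(\<forall>z\<in>T. 0 \<le> f z) \<or> (\<forall>z\<in>T. f z \<le> 0)"
  shows "affine_fun_on (convex hull T) (\<lambda>z. \<bar>f z\<bar>)"
proof -
  have "affine_fun_on (convex hull T) (\<lambda>z. max (f z) (-1 * f z))"
    using assms by (intro affine_fun_on_hull_max affine_fun_on_mult_left) auto
  then show ?thesis by (rule affine_fun_on_cong) (auto simp: max_def)
qed

definition affine_on_mesh :: "mesh \<Rightarrow> (real \<times> real \<Rightarrow> real) \<Rightarrow> bool" where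
  "affine_on_mesh M f \<longleftrightarrow> (\<forall>T\<in>M. affine_fun_on (convex hull T) f)"

lemma affine_on_mesh_eqI:
  assumes "unit_square \<subseteq> (\<Union>T\<in>M. convex hull T)"
    and "affine_on_mesh M f" "affine_on_mesh M g" "\<And>p. p \<in> \<Union>M \<Longrightarrow> f p = g p"
    and "z \<in> unit_square"
  shows "f z = g z"
proof -
  obtain T where T: "T \<in> M" "z \<in> convex hull T" using assms(1,5) by blast
  have "\<forall>p\<in>T. f p = g p" using assms(4) T(1) by blast
  with assms(2,3) T show ?thesis
    by (intro antisym affine_fun_on_hull_le[of T _ _ z]) (auto simp: affine_on_mesh_def)
qed

lemma U_h_iff:
  "v \<in> U_h M \<longleftrightarrow> v \<in> extensional unit_square \<and> continuous_on unit_square v \<and> affine_on_mesh M v"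
  by (simp add: U_h_def affine_on_mesh_def affine_fun_on_def case_prod_beta)

lemma convex_unit_square: "convex unit_square"
  by (simp add: unit_square_def convex_Times)

lemma restrict_in_U_h:
  assumes "\<Union>M \<subseteq> unit_square" "continuous_on UNIV f" "affine_on_mesh M f"
  shows "restrict f unit_square \<in> U_h M"
proof -
  have "affine_fun_on (convex hull T) (restrict f unit_square)" if "T \<in> M" for T
  proof (rule affine_fun_on_cong)
    show "affine_fun_on (convex hull T) f" using assms(3) that by (simp add: affine_on_mesh_def)
    have "convex hull T \<subseteq> unit_square"
      using assms(1) that convex_unit_square by (intro hull_minimal) auto
    then show "restrict f unit_square z = f z" if "z \<in> convex hull T" for z using that by auto
  qed
  moreover have "continuous_on unit_square (restrict f unit_square)"
    using assms(2) by (metis continuous_on_cong continuous_on_subset restrict_apply subset_UNIV)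
  ultimately show ?thesis by (simp add: U_h_iff affine_on_mesh_def)
qed

lemma in_hull_triangle:
  assumes "z = u *\<^sub>R A + v *\<^sub>R B + w *\<^sub>R C" "0 \<le> u" "0 \<le> v" "0 \<le> w" "u + v + w = 1"
  shows "z \<in> convex hull {A, B, C}"
  using assms unfolding convex_hull_3 by blast

lemma square_subset_cut_up:
  "{a..a + 1/2} \<times> {b..b + 1/2} \<subseteq> (\<Union>T\<in>cut_up a b. convex hull T)"
proof clarify
  fix x y assume xy: "x \<in> {a..a + 1/2}" "y \<in> {b..b + 1/2}"
  have "(x, y) \<in> convex hull {(a, b), (a + 1/2, b + 1/2), (a + 1/2, b)}" if "y - b \<le> x - a"
    using xy that by (intro in_hull_triangle[of _ "1 - 2*(x - a)" _ "2*(y - b)" _ "2*(x - a) - 2*(y - b)"])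
      (auto simp: algebra_simps)
  moreover have "(x, y) \<in> convex hull {(a, b), (a + 1/2, b + 1/2), (a, b + 1/2)}" if "x - a \<le> y - b"
    using xy that by (intro in_hull_triangle[of _ "1 - 2*(y - b)" _ "2*(x - a)" _ "2*(y - b) - 2*(x - a)"])
      (auto simp: algebra_simps)
  ultimately show "(x, y) \<in> (\<Union>T\<in>cut_up a b. convex hull T)"
    unfolding cut_up_def by (cases "y - b \<le> x - a") auto
qed

lemma square_subset_cut_down:
  "{a..a + 1/2} \<times> {b..b + 1/2} \<subseteq> (\<Union>T\<in>cut_down a b. convex hull T)"
proof clarify
  fix x y assume xy: "x \<in> {a..a + 1/2}" "y \<in> {b..b + 1/2}"
  have "(x, y) \<in> convex hull {(a, b + 1/2), (a + 1/2, b), (a, b)}" if "(x - a) + (y - b) \<le> 1/2"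
    using xy that by (intro in_hull_triangle[of _ "2*(y - b)" _ "2*(x - a)" _ "1 - 2*(x - a) - 2*(y - b)"])
      (auto simp: algebra_simps)
  moreover have "(x, y) \<in> convex hull {(a, b + 1/2), (a + 1/2, b), (a + 1/2, b + 1/2)}"
    if "1/2 \<le> (x - a) + (y - b)"
    using xy that by (intro in_hull_triangle[of _ "1 - 2*(x - a)" _ "1 - 2*(y - b)" _ "2*(x - a) + 2*(y - b) - 1"])
      (auto simp: algebra_simps)
  ultimately show "(x, y) \<in> (\<Union>T\<in>cut_down a b. convex hull T)"
    unfolding cut_down_def by (cases "(x - a) + (y - b) \<le> 1/2") auto
qed

lemma mesh1_covers: "unit_square \<subseteq> (\<Union>T\<in>mesh1. convex hull T)"
proof (clarsimp simp: unit_square_def)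
  fix x y :: real assume xy: "0 \<le> x" "x \<le> 1" "0 \<le> y" "y \<le> 1"
  have "(x, y) \<in> convex hull {(0, 0), (1, 0), (1/2, 1/2)}" if "y \<le> x" "x + y \<le> 1"
    using xy that by (intro in_hull_triangle[of _ "1 - x - y" _ "x - y" _ "2 * y"]) (auto simp: algebra_simps)
  moreover have "(x, y) \<in> convex hull {(1, 0), (1, 1), (1/2, 1/2)}" if "y \<le> x" "1 \<le> x + y"
    using xy that by (intro in_hull_triangle[of _ "x - y" _ "x + y - 1" _ "2 * (1 - x)"]) (auto simp: algebra_simps)
  moreover have "(x, y) \<in> convex hull {(1, 1), (0, 1), (1/2, 1/2)}" if "x \<le> y" "1 \<le> x + y"
    using xy that by (intro in_hull_triangle[of _ "x + y - 1" _ "y - x" _ "2 * (1 - y)"]) (auto simp: algebra_simps)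
  moreover have "(x, y) \<in> convex hull {(0, 1), (0, 0), (1/2, 1/2)}" if "x \<le> y" "x + y \<le> 1"
    using xy that by (intro in_hull_triangle[of _ "y - x" _ "1 - x - y" _ "2 * x"]) (auto simp: algebra_simps)
  ultimately show "\<exists>T\<in>mesh1. (x, y) \<in> convex hull T"
    unfolding mesh1_def by (cases "y \<le> x"; cases "x + y \<le> 1") auto
qed

lemma subsquares_cover_unit_square:
  assumes "\<And>a b. a \<in> {0, 1/2} \<Longrightarrow> b \<in> {0, 1/2} \<Longrightarrow> cut_up a b \<subseteq> M \<or> cut_down a b \<subseteq> M"
  shows "unit_square \<subseteq> (\<Union>T\<in>M. convex hull T)"
proof
  fix z :: "real \<times> real" assume z: "z \<in> unit_square"
  define a where "a = (if fst z \<le> 1/2 then 0 else 1/2 :: real)"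
  define b where "b = (if snd z \<le> 1/2 then 0 else 1/2 :: real)"
  have "z \<in> {a..a + 1/2} \<times> {b..b + 1/2}"
    using z by (auto simp: a_def b_def unit_square_def mem_Times_iff)
  moreover have "cut_up a b \<subseteq> M \<or> cut_down a b \<subseteq> M"
    by (rule assms) (auto simp: a_def b_def)
  ultimately show "z \<in> (\<Union>T\<in>M. convex hull T)"
    using square_subset_cut_up[of a b] square_subset_cut_down[of a b] by blast
qed

lemma mesh2_covers: "unit_square \<subseteq> (\<Union>T\<in>mesh2. convex hull T)"
  by (rule subsquares_cover_unit_square) (unfold mesh2_def, blast)

lemma mesh3_covers: "unit_square \<subseteq> (\<Union>T\<in>mesh3. convex hull T)"
  by (rule subsquares_cover_unit_square) (unfold mesh3_def, blast)

lemma mesh4_covers: "unit_square \<subseteq> (\<Union>T\<in>mesh4. convex hull T)"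
  by (rule subsquares_cover_unit_square) (unfold mesh4_def, blast)

section \<open>Integration over the unit square\<close>

lemma unit_square_eq_cbox: "unit_square = cbox (0, 0) (1, 1)"
  by (simp add: unit_square_def cbox_Pair_eq)

lemma open_unit_square_eq_box: "open_unit_square = box (0, 0) (1, 1)"
  by (auto simp: open_unit_square_def box_def Basis_prod_def)

lemma open_unit_square_subset: "open_unit_square \<subseteq> unit_square"
  by (auto simp: open_unit_square_def unit_square_def)

lemma sets_open_unit_square [measurable]: "open_unit_square \<in> sets borel"
  by (simp add: open_unit_square_eq_box)

lemma set_integrable_bounded_square:
  fixes f :: "real \<times> real \<Rightarrow> real"
  assumes "S \<in> sets borel" "S \<subseteq> unit_square" "f \<in> borel_measurable borel"
    and "\<And>z. z \<in> S \<Longrightarrow> \<bar>f z\<bar> \<le> B"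
  shows "set_integrable lborel S f"
  unfolding set_integrable_def
proof (rule integrableI_bounded_set_indicator[where B = B])
  have "emeasure lborel S \<le> emeasure lborel (cbox (0, 0) (1, 1 :: real) :: (real \<times> real) set)"
    using assms(2) by (intro emeasure_mono) (auto simp: unit_square_eq_cbox)
  also have "\<dots> < \<infinity>" by (rule emeasure_lborel_cbox_finite)
  finally show "emeasure lborel S < \<infinity>" .
  show "AE z in lborel. z \<in> S \<longrightarrow> norm (f z) \<le> B" using assms(4) by (intro AE_I2) simp
qed (use assms(1,3) in simp_all)

lemma bounded_on_unit_square:
  fixes f :: "real \<times> real \<Rightarrow> real"
  assumes "continuous_on UNIV f"
  obtains B where "\<And>z. z \<in> unit_square \<Longrightarrow> \<bar>f z\<bar> \<le> B"
proof -
  have "compact (f ` unit_square)"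
    using assms by (intro compact_continuous_image) (auto simp: unit_square_eq_cbox intro: continuous_on_subset)
  then show ?thesis using that compact_imp_bounded[of "f ` unit_square"] by (auto simp: bounded_iff)
qed

lemma set_integrable_continuous_square:
  fixes f :: "real \<times> real \<Rightarrow> real"
  assumes "S \<in> sets borel" "S \<subseteq> unit_square" "continuous_on UNIV f"
  shows "set_integrable lborel S f"
proof -
  obtain B where "\<And>z. z \<in> unit_square \<Longrightarrow> \<bar>f z\<bar> \<le> B"
    using bounded_on_unit_square[OF assms(3)] by blast
  with assms show ?thesis
    by (intro set_integrable_bounded_square[where B = B] borel_measurable_continuous_onI) auto
qed

lemma set_integrable_open_square:
  fixes f :: "real \<times> real \<Rightarrow> real"
  assumes "continuous_on UNIV f"
  shows "set_integrable lborel open_unit_square f"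
  using assms by (intro set_integrable_continuous_square open_unit_square_subset) auto

lemma LINT_open_unit_square:
  fixes f :: "real \<times> real \<Rightarrow> real"
  assumes "continuous_on UNIV f"
  shows "(LINT z:open_unit_square|lborel. f z) = integral unit_square f"
  unfolding set_borel_integral_eq_integral(2)[OF set_integrable_open_square[OF assms]]
  by (simp add: unit_square_eq_cbox open_unit_square_eq_box integral_open_interval)

text \<open>The passage from equality of integrals to equality at every point, which turns strict convexity
  of the integrand into uniqueness of minimisers.\<close>

lemma LINT_nonpos_imp_zero:
  fixes f :: "real \<times> real \<Rightarrow> real"
  assumes "continuous_on UNIV f" "\<And>z. 0 \<le> f z" "(LINT z:open_unit_square|lborel. f z) \<le> 0"
    and "z \<in> unit_square"
  shows "f z = 0"
proof -
  have cont: "continuous_on (cbox (0, 0) (1, 1)) f" using assms(1) by (rule continuous_on_subset) simp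
  have "integral (cbox (0, 0) (1, 1)) f = 0"
    using assms(2,3) LINT_open_unit_square[OF assms(1)]
    by (intro antisym integral_nonneg integrable_continuous cont) (auto simp: unit_square_eq_cbox)
  then have "(f has_integral 0) (cbox (0, 0) (1, 1))"
    using integrable_continuous[OF cont] by (simp add: has_integral_integral)
  moreover have "(1/2, 1/2) \<in> box (0 :: real, 0 :: real) (1, 1)"
    by (simp flip: open_unit_square_eq_box add: open_unit_square_def)
  ultimately show ?thesis
    using has_integral_0_cbox_imp_0[of "(0, 0)" "(1, 1)" f z] cont assms(2,4)
    by (metis unit_square_eq_cbox empty_iff)
qed

text \<open>Fubini for a region between two graphs over \<open>(a, b)\<close>. The inner and outer integrals are
  taken in the Henstock-Kurzweil sense, where the fundamental theorem of calculus tolerates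
  exceptional points; this is what integrands containing \<open>sgn\<close> need.\<close>

lemma integral_vertical_slices:
  fixes f :: "real \<times> real \<Rightarrow> real" and l u G :: "real \<Rightarrow> real"
  assumes [measurable]: "f \<in> borel_measurable borel" "l \<in> borel_measurable borel" "u \<in> borel_measurable borel"
    and S: "S = {z. a < fst z \<and> fst z < b \<and> l (fst z) < snd z \<and> snd z < u (fst z)}" "S \<subseteq> unit_square"
    and bound: "\<And>z. z \<in> S \<Longrightarrow> \<bar>f z\<bar> \<le> B"
    and inner: "\<And>x. a < x \<Longrightarrow> x < b \<Longrightarrow> ((\<lambda>y. f (x, y)) has_integral G x) {l x..u x}"
    and outer: "(G has_integral I) {a..b}"
  shows "(LINT z:S|lborel. f z) = I"
proof -
  have "{z \<in> space (borel \<Otimes>\<^sub>M borel). a < fst z \<and> fst z < b \<and> l (fst z) < snd z \<and> snd z < u (fst z)}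
      \<in> sets (borel \<Otimes>\<^sub>M borel)"
    by measurable
  then have S_meas: "S \<in> sets borel" unfolding borel_prod by (simp add: S(1))
  have int: "integrable (lborel \<Otimes>\<^sub>M lborel) (\<lambda>z. indicator S z *\<^sub>R f z)"
    using set_integrable_bounded_square[OF S_meas S(2) assms(1) bound]
    by (simp add: set_integrable_def lborel_prod)
  have slice: "(LINT y|lborel. indicator S (x, y) *\<^sub>R f (x, y)) = indicator {a<..<b} x *\<^sub>R G x" for x
  proof (cases "a < x \<and> x < b")
    case True
    have "set_integrable lborel {l x<..<u x} (\<lambda>y. f (x, y))"
      unfolding set_integrable_def
    proof (rule integrableI_bounded_set_indicator[where B = B])
      have "(\<lambda>y. f (x, y)) \<in> borel_measurable borel"
        by (rule measurable_compose[OF borel_measurable_continuous_onI assms(1)]) (intro continuous_intros)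
      then show "(\<lambda>y. f (x, y)) \<in> borel_measurable lborel" by simp
      show "emeasure lborel {l x<..<u x} < \<infinity>"
        using emeasure_lborel_box_finite[of "l x" "u x"] by simp
      show "AE y in lborel. y \<in> {l x<..<u x} \<longrightarrow> norm (f (x, y)) \<le> B"
        using True bound by (intro AE_I2) (simp add: S(1))
    qed simp
    from set_borel_integral_eq_integral(2)[OF this]
    have "(LINT y:{l x<..<u x}|lborel. f (x, y)) = G x"
      using inner[of x] True by (simp add: integral_open_interval[where 'a = real, simplified] integral_unique)
    moreover have "indicator S (x, y) = indicat_real {l x<..<u x} y" for y
      using True by (simp add: S(1) indicator_def)
    ultimately show ?thesis using True by (simp add: set_lebesgue_integral_def)
  next
    case False
    then have "indicator S (x, y) = (0 :: real)" for y by (auto simp: S(1) indicator_def)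
    with False show ?thesis by auto
  qed
  have "set_integrable lborel {a<..<b} G"
    using lborel_pair.integrable_fst'[OF int] by (simp only: set_integrable_def slice)
  from set_borel_integral_eq_integral(2)[OF this]
  have "(LINT x:{a<..<b}|lborel. G x) = I"
    using outer by (simp add: integral_open_interval[where 'a = real, simplified] integral_unique)
  then show ?thesis
    using lborel_pair.integral_fst'[OF int] by (simp only: set_lebesgue_integral_def slice lborel_prod)
qed

text \<open>Exchange of the coordinates reduces this to vertical slices.\<close>

lemma integral_horizontal_slices:
  fixes f :: "real \<times> real \<Rightarrow> real" and l u G :: "real \<Rightarrow> real"
  assumes [measurable]: "f \<in> borel_measurable borel" "l \<in> borel_measurable borel" "u \<in> borel_measurable borel"
    and S: "S = {z. a < snd z \<and> snd z < b \<and> l (snd z) < fst z \<and> fst z < u (snd z)}" "S \<subseteq> unit_square"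
    and bound: "\<And>z. z \<in> S \<Longrightarrow> \<bar>f z\<bar> \<le> B"
    and inner: "\<And>y. a < y \<Longrightarrow> y < b \<Longrightarrow> ((\<lambda>x. f (x, y)) has_integral G y) {l y..u y}"
    and outer: "(G has_integral I) {a..b}"
  shows "(LINT z:S|lborel. f z) = I"
proof -
  let ?S = "{z. a < fst z \<and> fst z < b \<and> l (fst z) < snd z \<and> snd z < u (fst z)}"
  have "{z \<in> space (borel \<Otimes>\<^sub>M borel). a < snd z \<and> snd z < b \<and> l (snd z) < fst z \<and> fst z < u (snd z)}
      \<in> sets (borel \<Otimes>\<^sub>M borel)"
    by measurable
  then have S_meas: "S \<in> sets borel" unfolding borel_prod by (simp add: S(1))
  have "(\<lambda>z. f (snd z, fst z)) \<in> borel_measurable borel"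
    by (rule measurable_compose[OF borel_measurable_continuous_onI assms(1)]) (intro continuous_intros)
  then have "(LINT z:?S|lborel. f (snd z, fst z)) = I"
  proof (rule integral_vertical_slices[OF _ assms(2,3) refl _ _ _ outer])
    show "?S \<subseteq> unit_square"
    proof
      fix z assume "z \<in> ?S"
      then have "(snd z, fst z) \<in> S" by (simp add: S(1))
      with S(2) show "z \<in> unit_square" by (cases z) (auto simp: unit_square_def)
    qed
    show "\<bar>f (snd z, fst z)\<bar> \<le> B" if "z \<in> ?S" for z
      using that bound[of "(snd z, fst z)"] by (simp add: S(1))
  qed (use inner in simp_all)
  moreover have "(LINT z|lborel. indicator S (snd z, fst z) *\<^sub>R f (snd z, fst z)) = (LINT z|lborel. indicator S z *\<^sub>R f z)"
  proof -
    have "(\<lambda>z. indicator S z *\<^sub>R f z) \<in> borel_measurable (lborel \<Otimes>\<^sub>M lborel)"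
      using S_meas by (simp add: lborel_prod)
    from lborel_pair.integral_product_swap[OF this] show ?thesis
      by (simp add: lborel_prod case_prod_beta')
  qed
  moreover have "indicator S (snd z, fst z) = indicat_real ?S z" for z
    by (simp add: S(1) indicator_def)
  ultimately show ?thesis by (simp add: set_lebesgue_integral_def)
qed

lemma AE_off_line:
  assumes "a \<noteq> 0 \<or> b \<noteq> 0"
  shows "AE z in (lborel :: (real \<times> real) measure). a * fst z + b * snd z \<noteq> c"
proof -
  let ?L = "{z. (a, b) \<bullet> z = c}"
  have "negligible ?L" using assms by (intro negligible_hyperplane) (auto simp: zero_prod_def)
  moreover have "?L \<in> sets borel" by (intro borel_closed closed_hyperplane)
  ultimately have "?L \<in> null_sets lborel"
    using null_sets_completion_iff[of ?L lborel] by (simp add: negligible_iff_null_sets)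
  then show ?thesis by (rule AE_I') (auto simp: inner_prod_def)
qed

text \<open>The pieces are given by an identity of indicator functions almost everywhere, so that
  open triangles may be used and their common edges ignored.\<close>

lemma set_integral_split:
  fixes f :: "'a::euclidean_space \<Rightarrow> real"
  assumes "\<And>T. T \<in> set Ts \<Longrightarrow> set_integrable lborel T f"
    and "AE z in lborel. indicat_real S z = (\<Sum>T\<leftarrow>Ts. indicat_real T z)"
    and "f \<in> borel_measurable borel" "S \<in> sets borel" "\<And>T. T \<in> set Ts \<Longrightarrow> T \<in> sets borel"
  shows "(LINT z:S|lborel. f z) = (\<Sum>T\<leftarrow>Ts. LINT z:T|lborel. f z)"
proof -
  have sum: "integrable lborel (\<lambda>z. (\<Sum>T\<leftarrow>Ts. indicat_real T z) *\<^sub>R f z) \<and>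
      (LINT z|lborel. (\<Sum>T\<leftarrow>Ts. indicat_real T z) *\<^sub>R f z) = (\<Sum>T\<leftarrow>Ts. LINT z:T|lborel. f z)"
    using assms(1)
    by (induction Ts) (auto simp: set_integrable_def set_lebesgue_integral_def distrib_right)
  have "(LINT z:S|lborel. f z) = (LINT z|lborel. (\<Sum>T\<leftarrow>Ts. indicat_real T z) *\<^sub>R f z)"
    unfolding set_lebesgue_integral_def
  proof (rule integral_cong_AE)
    show "(\<lambda>z. indicat_real S z *\<^sub>R f z) \<in> borel_measurable lborel" using assms(3,4) by simp
    show "(\<lambda>z. (\<Sum>T\<leftarrow>Ts. indicat_real T z) *\<^sub>R f z) \<in> borel_measurable lborel"
      using sum by (intro borel_measurable_integrable) simp
    show "AE z in lborel. indicat_real S z *\<^sub>R f z = (\<Sum>T\<leftarrow>Ts. indicat_real T z) *\<^sub>R f z"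
      using assms(2) by eventually_elim simp
  qed
  with sum show ?thesis by simp
qed

text \<open>The substitution \<open>x \<mapsto> 1 - x\<close> maps the integral to its negative.\<close>

lemma antisymmetric_integral_zero:
  fixes g :: "real \<times> real \<Rightarrow> real"
  assumes "g \<in> borel_measurable borel" "\<And>z. z \<in> open_unit_square \<Longrightarrow> \<bar>g z\<bar> \<le> B"
    and anti: "\<And>x y. (x, y) \<in> open_unit_square \<Longrightarrow> g (1 - x, y) = - g (x, y)"
  shows "(LINT z:open_unit_square|lborel. g z) = 0"
proof -
  define h where "h = (\<lambda>x y. indicator open_unit_square (x, y) *\<^sub>R g (x, y))"
  have h_anti: "h (1 - x) y = - h x y" for x y
    using anti[of x y] by (auto simp: h_def indicator_def open_unit_square_def)
  have int: "integrable (lborel \<Otimes>\<^sub>M lborel) (case_prod h)"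
    using set_integrable_bounded_square[OF sets_open_unit_square open_unit_square_subset assms(1,2)]
    by (simp add: set_integrable_def lborel_prod h_def case_prod_beta')
  have "(LINT x|lborel. h x y) = 0" for y
    using lborel_integral_real_affine[of "-1" "\<lambda>x. h x y" 1] by (simp add: h_anti)
  then have "integral\<^sup>L (lborel \<Otimes>\<^sub>M lborel) (case_prod h) = 0"
    using lborel_pair.integral_snd[OF int] by simp
  then show ?thesis
    by (simp add: set_lebesgue_integral_def lborel_prod h_def case_prod_beta')
qed

section \<open>Best approximation by a finite-dimensional family\<close>

text \<open>The parameter \<open>p\<close> collects the free coefficients, and the last assumption says that the shape
  functions are linearly independent on the open square. The function to be approximated is the
  abscissa, because \<open>1 - (1 - x + \<phi> p) = x - \<phi> p\<close>.\<close>

locale shape_functions =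
  fixes \<phi> :: "'p::euclidean_space \<Rightarrow> real \<times> real \<Rightarrow> real"
  assumes linear_shape: "linear (\<lambda>p. \<phi> p z)"
    and continuous_shape: "continuous_on UNIV (\<phi> p)"
    and shape_eq_0: "(\<And>z. z \<in> open_unit_square \<Longrightarrow> \<phi> p z = 0) \<Longrightarrow> p = 0"
begin

definition err :: "'p \<Rightarrow> real \<times> real \<Rightarrow> real" where
  "err p z = fst z - \<phi> p z"

definition cost :: "real \<Rightarrow> 'p \<Rightarrow> real" where
  "cost q p = (LINT z:open_unit_square|lborel. \<bar>err p z\<bar> powr q)"

definition minimiser :: "real \<Rightarrow> 'p \<Rightarrow> bool" where
  "minimiser q p \<longleftrightarrow> (\<forall>p'. cost q p \<le> cost q p')"

lemma shape_add: "\<phi> (p + p') z = \<phi> p z + \<phi> p' z"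
  using linear_shape by (rule linear_add)

lemma shape_diff: "\<phi> (p - p') z = \<phi> p z - \<phi> p' z"
  using linear_shape by (rule linear_diff)

lemma shape_scaleR: "\<phi> (c *\<^sub>R p) z = c * \<phi> p z"
  using linear_cmul[OF linear_shape] by simp

lemma continuous_on_shape [continuous_intros]:
  "continuous_on S g \<Longrightarrow> continuous_on S (\<lambda>x. \<phi> p (g x))"
  using continuous_on_compose2[OF continuous_shape] by blast

lemma continuous_on_err [continuous_intros]:
  "continuous_on S g \<Longrightarrow> continuous_on S (\<lambda>x. err p (g x))"
  unfolding err_def by (intro continuous_intros)

lemma integrable_cost:
  assumes "0 < q"
  shows "set_integrable lborel open_unit_square (\<lambda>z. \<bar>err p z\<bar> powr q)"
  using assms by (intro set_integrable_open_square continuous_intros)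

lemma integrable_abs_shape: "set_integrable lborel open_unit_square (\<lambda>z. \<bar>\<phi> p z\<bar>)"
  by (intro set_integrable_open_square continuous_intros)

text \<open>Integrating the subgradient inequality between \<open>err p\<close> and \<open>err p'\<close> leaves a linear term, which
  is the integral of \<open>w\<close> against the shape function of \<open>p - p'\<close> and vanishes. For \<open>q = 1\<close> the function \<open>w\<close> is
  determined by the sign of the error only where the error does not vanish.\<close>

lemma minimiser_if_orthogonal:
  assumes q: "1 \<le> q"
    and w: "w \<in> borel_measurable borel" "\<And>z. z \<in> open_unit_square \<Longrightarrow> \<bar>w z\<bar> \<le> B"
    and tangent: "\<And>z y. z \<in> open_unit_square \<Longrightarrow> \<bar>err p z\<bar> powr q + q * w z * (y - err p z) \<le> \<bar>y\<bar> powr q"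
    and orth: "\<And>d. (LINT z:open_unit_square|lborel. w z * \<phi> d z) = 0"
  shows "minimiser q p"
  unfolding minimiser_def
proof
  fix p'
  let ?d = "p - p'"
  obtain C where C: "\<And>z. z \<in> unit_square \<Longrightarrow> \<bar>\<phi> ?d z\<bar> \<le> C"
    using bounded_on_unit_square[OF continuous_shape] by blast
  have [measurable]: "\<phi> ?d \<in> borel_measurable borel"
    by (rule borel_measurable_continuous_onI[OF continuous_shape])
  note w(1)[measurable]
  have "\<bar>w z * \<phi> ?d z\<bar> \<le> B * C" if "z \<in> open_unit_square" for z
    unfolding abs_mult using that C[of z] w(2)[of z] open_unit_square_subset
    by (intro mult_mono) auto
  then have int: "set_integrable lborel open_unit_square (\<lambda>z. w z * \<phi> ?d z)"
    by (intro set_integrable_bounded_square[where B = "B * C"] open_unit_square_subset) auto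
  have "cost q p = cost q p + q * (LINT z:open_unit_square|lborel. w z * \<phi> ?d z)"
    using orth by simp
  also have "\<dots> = (LINT z:open_unit_square|lborel. \<bar>err p z\<bar> powr q + q * (w z * \<phi> ?d z))"
    unfolding cost_def using int integrable_cost[of q p] q
    by (simp add: set_integral_add(2) set_integral_mult_right)
  also have "\<dots> \<le> cost q p'"
    unfolding cost_def
  proof (rule set_integral_mono)
    show "set_integrable lborel open_unit_square (\<lambda>z. \<bar>err p z\<bar> powr q + q * (w z * \<phi> ?d z))"
      using int integrable_cost[of q p] q by (intro set_integral_add set_integrable_mult_right) auto
    show "set_integrable lborel open_unit_square (\<lambda>z. \<bar>err p' z\<bar> powr q)"
      using q by (intro integrable_cost) simp
    show "\<bar>err p z\<bar> powr q + q * (w z * \<phi> ?d z) \<le> \<bar>err p' z\<bar> powr q" if "z \<in> open_unit_square" for z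
      using tangent[OF that, of "err p' z"] by (simp add: err_def shape_diff mult.assoc)
  qed
  finally show "cost q p \<le> cost q p'" .
qed

lemma err_midpoint: "err ((1/2) *\<^sub>R (p + p')) z = (err p z + err p' z) / 2"
  by (simp add: err_def shape_add shape_scaleR field_simps)

text \<open>The midpoint of two minimisers cannot have smaller cost, so the convexity inequality is an
  equality after integration and hence, by continuity, at every point.\<close>

lemma minimisers_midpoint_eq:
  assumes q: "1 \<le> q" and "minimiser q p" "minimiser q p'" "z \<in> unit_square"
  shows "\<bar>err p z\<bar> powr q + \<bar>err p' z\<bar> powr q = 2 * \<bar>(err p z + err p' z) / 2\<bar> powr q"
proof -
  let ?m = "(1/2) *\<^sub>R (p + p')"
  let ?f = "\<lambda>z. \<bar>err p z\<bar> powr q + \<bar>err p' z\<bar> powr q - 2 * \<bar>err ?m z\<bar> powr q"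
  have "(LINT z:open_unit_square|lborel. ?f z) = cost q p + cost q p' - 2 * cost q ?m"
    unfolding cost_def using q integrable_cost[of q]
    by (subst set_integral_diff(2)) (auto simp: set_integral_add)
  also have "\<dots> \<le> 0" using assms(2,3) unfolding minimiser_def by (smt (verit))
  finally have "(LINT z:open_unit_square|lborel. ?f z) \<le> 0" .
  moreover have "0 \<le> ?f z" for z
    using abs_powr_midpoint[OF q, of "err p z" "err p' z"] by (simp only: err_midpoint diff_ge_0_iff_ge)
  moreover have "continuous_on UNIV ?f"
    using q by (intro continuous_intros) simp_all
  ultimately have "?f z = 0" using assms(4) by (intro LINT_nonpos_imp_zero)
  then show ?thesis unfolding err_midpoint by linarith
qed

lemma minimiser_unique:
  assumes "1 < q" "minimiser q p" "minimiser q p'"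
  shows "p = p'"
proof -
  have "\<phi> (p - p') z = 0" if "z \<in> open_unit_square" for z
  proof -
    have "err p z = err p' z"
      using minimisers_midpoint_eq[of q p p' z] abs_powr_midpoint_strict[of q "err p z" "err p' z"]
        assms that open_unit_square_subset by force
    then show ?thesis by (simp add: err_def shape_diff)
  qed
  then show ?thesis using shape_eq_0[of "p - p'"] by simp
qed

lemma minimisers_same_sign:
  assumes "minimiser 1 p" "minimiser 1 p'" "z \<in> unit_square"
  shows "0 \<le> err p z * err p' z"
proof -
  have "\<bar>err p z\<bar> + \<bar>err p' z\<bar> = \<bar>err p z + err p' z\<bar>"
    using minimisers_midpoint_eq[of 1 p p' z] assms by simp
  then show ?thesis by (simp add: abs_if zero_le_mult_iff split: if_splits)
qed

lemma convex_on_cost: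
  assumes "1 \<le> q"
  shows "convex_on UNIV (cost q)"
proof (rule convex_onI)
  fix t :: real and p p' :: 'p assume t: "0 < t" "t < 1"
  let ?m = "(1 - t) *\<^sub>R p + t *\<^sub>R p'"
  have eq: "err ?m z = (1 - t) *\<^sub>R err p z + t *\<^sub>R err p' z" for z
    unfolding err_def shape_add shape_scaleR by (simp add: algebra_simps)
  have int: "set_integrable lborel open_unit_square (\<lambda>z. \<bar>err p z\<bar> powr q)" for p
    using assms by (intro integrable_cost) simp
  have "cost q ?m \<le> (LINT z:open_unit_square|lborel. (1 - t) * \<bar>err p z\<bar> powr q + t * \<bar>err p' z\<bar> powr q)"
    unfolding cost_def
  proof (rule set_integral_mono)
    show "\<bar>err ?m z\<bar> powr q \<le> (1 - t) * \<bar>err p z\<bar> powr q + t * \<bar>err p' z\<bar> powr q" for z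
      unfolding eq using t by (intro convex_onD[OF convex_on_abs_powr[OF assms]]) auto
  qed (intro int set_integral_add set_integrable_mult_right)+
  also have "\<dots> = (1 - t) * cost q p + t * cost q p'"
    unfolding cost_def using int by (simp add: set_integral_add(2) set_integral_mult_right)
  finally show "cost q ?m \<le> (1 - t) * cost q p + t * cost q p'" .
qed simp

text \<open>By linear independence the integral is a norm of \<open>p\<close>, and norms on a finite-dimensional space are
  equivalent: \<open>m\<close> is its minimum over the unit sphere.\<close>

lemma abs_shape_integral_lower_bound:
  obtains m where "0 < m" "\<And>p. m * norm p \<le> (LINT z:open_unit_square|lborel. \<bar>\<phi> p z\<bar>)"
proof -
  define N where "N p = (LINT z:open_unit_square|lborel. \<bar>\<phi> p z\<bar>)" for p
  have N_scale: "N (c *\<^sub>R p) = \<bar>c\<bar> * N p" for c p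
    by (simp add: N_def shape_scaleR abs_mult set_integral_mult_right)
  have N_pos: "0 < N p" if "p \<noteq> 0" for p
  proof (rule ccontr)
    assume "\<not> 0 < N p"
    then have "\<bar>\<phi> p z\<bar> = 0" if "z \<in> unit_square" for z
      using that unfolding N_def by (intro LINT_nonpos_imp_zero continuous_intros) auto
    then show False using shape_eq_0[of p] \<open>p \<noteq> 0\<close> open_unit_square_subset by auto
  qed
  have "convex_on UNIV N"
  proof (rule convex_onI)
    fix t :: real and p p' :: 'p assume t: "0 < t" "t < 1"
    have "N ((1 - t) *\<^sub>R p + t *\<^sub>R p') \<le> (LINT z:open_unit_square|lborel. (1 - t) * \<bar>\<phi> p z\<bar> + t * \<bar>\<phi> p' z\<bar>)"
      unfolding N_def
    proof (rule set_integral_mono)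
      show "\<bar>\<phi> ((1 - t) *\<^sub>R p + t *\<^sub>R p') z\<bar> \<le> (1 - t) * \<bar>\<phi> p z\<bar> + t * \<bar>\<phi> p' z\<bar>" for z
        using t abs_triangle_ineq[of "(1 - t) * \<phi> p z" "t * \<phi> p' z"]
        by (simp add: shape_add shape_scaleR abs_mult)
    qed (intro integrable_abs_shape set_integral_add set_integrable_mult_right)+
    also have "\<dots> = (1 - t) * N p + t * N p'"
      unfolding N_def using integrable_abs_shape by (simp add: set_integral_add(2) set_integral_mult_right)
    finally show "N ((1 - t) *\<^sub>R p + t *\<^sub>R p') \<le> (1 - t) * N p + t * N p'" .
  qed simp
  then have "continuous_on (sphere 0 1) N"
    using convex_on_continuous[OF open_UNIV] continuous_on_subset by blast
  then obtain p0 where p0: "p0 \<in> sphere 0 1" "\<And>p. p \<in> sphere 0 1 \<Longrightarrow> N p0 \<le> N p"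
    using continuous_attains_inf[of "sphere (0::'p) 1" N] by (metis compact_sphere sphere_eq_empty not_less zero_le_one dual_order.strict_iff_not)
  show thesis
  proof (rule that)
    show "0 < N p0" using p0(1) by (intro N_pos) auto
    fix p
    show "N p0 * norm p \<le> (LINT z:open_unit_square|lborel. \<bar>\<phi> p z\<bar>)"
    proof (cases "p = 0")
      case False
      then have "N p0 \<le> N ((1 / norm p) *\<^sub>R p)" by (intro p0(2)) simp
      then show ?thesis using False unfolding N_scale by (simp add: N_def field_simps)
    next
      case True
      then show ?thesis using N_scale[of 0 0] by (simp add: N_def)
    qed
  qed
qed

text \<open>Since \<open>\<bar>y\<bar> - 1 \<le> \<bar>y\<bar>\<^sup>q\<close>, the cost is bounded below by a norm minus a constant. A minimum over a large
  ball is therefore global; continuity of the cost comes for free from convexity.\<close>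

lemma minimiser_exists:
  assumes "1 \<le> q"
  obtains p where "minimiser q p"
proof -
  obtain m where m: "0 < m" "\<And>p. m * norm p \<le> (LINT z:open_unit_square|lborel. \<bar>\<phi> p z\<bar>)"
    using abs_shape_integral_lower_bound by blast
  have coercive: "m * norm p - (LINT z:open_unit_square|lborel. 2) \<le> cost q p" for p
  proof -
    have int2: "set_integrable lborel open_unit_square (\<lambda>z. 2 :: real)"
      by (intro set_integrable_open_square continuous_intros)
    have "m * norm p - (LINT z:open_unit_square|lborel. 2) \<le> (LINT z:open_unit_square|lborel. \<bar>\<phi> p z\<bar> - 2)"
      using m(2)[of p] integrable_abs_shape[of p] int2 by (simp add: set_integral_diff(2))
    also have "\<dots> \<le> cost q p"
      unfolding cost_def
    proof (rule set_integral_mono)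
      fix z assume z: "z \<in> open_unit_square"
      have "\<bar>err p z\<bar> - 1 \<le> \<bar>err p z\<bar> powr q"
      proof (cases "1 \<le> \<bar>err p z\<bar>")
        case True
        then show ?thesis using powr_mono[of 1 q "\<bar>err p z\<bar>"] assms by simp
      next
        case False
        then show ?thesis using powr_ge_zero[of "\<bar>err p z\<bar>" q] by linarith
      qed
      moreover have "\<bar>\<phi> p z\<bar> - 1 \<le> \<bar>err p z\<bar>"
        using z by (auto simp: err_def open_unit_square_def)
      ultimately show "\<bar>\<phi> p z\<bar> - 2 \<le> \<bar>err p z\<bar> powr q" by linarith
    qed (use assms int2 integrable_abs_shape integrable_cost in \<open>auto intro: set_integral_diff\<close>)
    finally show ?thesis .
  qed
  define R where "R = (cost q 0 + (LINT z:open_unit_square|lborel. 2)) / m"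
  have outside: "cost q 0 < cost q p" if "p \<notin> cball 0 R" for p
    using coercive[of p] that m(1) by (auto simp: R_def field_simps)
  have "0 \<le> R" using coercive[of 0] m(1) by (simp add: R_def)
  have "continuous_on (cball 0 R) (cost q)"
    using convex_on_continuous[OF open_UNIV convex_on_cost[OF assms]] continuous_on_subset by blast
  then obtain p where p: "p \<in> cball 0 R" "\<And>p'. p' \<in> cball 0 R \<Longrightarrow> cost q p \<le> cost q p'"
    using continuous_attains_inf[of "cball 0 R" "cost q"] \<open>0 \<le> R\<close> by auto
  have "cost q p \<le> cost q p'" for p'
    using p(2)[of p'] p(2)[of 0] outside[of p'] \<open>0 \<le> R\<close> by (cases "p' \<in> cball 0 R") auto
  then show thesis using that[of p] by (simp add: minimiser_def)
qed

end

section \<open>The admissible functions of a mesh\<close>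

text \<open>The shape functions of a mesh span the piecewise affine functions that vanish on the two vertical
  sides. By the last assumption they attain arbitrary values at the free nodes.\<close>

locale mesh_shape_functions = shape_functions \<phi> for \<phi> :: "'p::euclidean_space \<Rightarrow> real \<times> real \<Rightarrow> real" +
  fixes M :: mesh
  assumes vertices_in_square: "\<Union>M \<subseteq> unit_square"
    and triangles_cover: "unit_square \<subseteq> (\<Union>T\<in>M. convex hull T)"
    and shape_affine: "affine_on_mesh M (\<phi> p)"
    and shape_boundary: "z \<in> unit_square \<Longrightarrow> fst z = 0 \<or> fst z = 1 \<Longrightarrow> \<phi> p z = 0"
    and interpolation: "\<exists>p. \<forall>z\<in>free_nodes M. \<phi> p z = f z"
begin

definition trial :: "'p \<Rightarrow> real \<times> real \<Rightarrow> real" where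
  "trial p = restrict (\<lambda>z. 1 - fst z + \<phi> p z) unit_square"

lemma trial_eq: "z \<in> unit_square \<Longrightarrow> trial p z = 1 - err p z"
  by (simp add: trial_def err_def)

lemma trial_affine: "affine_on_mesh M (\<lambda>z. 1 - fst z + \<phi> p z)"
  using shape_affine[of p] unfolding affine_on_mesh_def
  by (auto intro!: affine_fun_on_add affine_fun_on_diff)

text \<open>A piecewise affine function is determined by its vertex values, and those at the vertices that are
  not free are prescribed by the boundary conditions.\<close>

lemma admissible_eq: "admissible M = range trial"
proof (intro equalityI subsetI)
  fix v assume "v \<in> range trial"
  then obtain p where v: "v = trial p" by blast
  have "v \<in> U_h M"
    unfolding v trial_def by (intro restrict_in_U_h vertices_in_square trial_affine continuous_intros)
  moreover have "v (0, y) = 1 \<and> v (1, y) = 0" if "y \<in> {0..1}" for y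
    using that shape_boundary[of "(0, y)" p] shape_boundary[of "(1, y)" p]
    by (simp add: v trial_def unit_square_def)
  ultimately show "v \<in> admissible M" by (simp add: admissible_def)
next
  fix v assume v: "v \<in> admissible M"
  then have U: "v \<in> extensional unit_square" "affine_on_mesh M v"
    by (auto simp: admissible_def U_h_iff)
  obtain p where p: "\<And>z. z \<in> free_nodes M \<Longrightarrow> \<phi> p z = v z - 1 + fst z"
    using interpolation[of "\<lambda>z. v z - 1 + fst z"] by blast
  have nodes: "v z = 1 - fst z + \<phi> p z" if "z \<in> \<Union>M" for z
  proof (cases "z \<in> free_nodes M")
    case False
    then have "fst z = 0 \<or> fst z = 1" using that by (auto simp: free_nodes_def)
    moreover have "z \<in> unit_square" using that vertices_in_square by blast
    ultimately show ?thesis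
      using v shape_boundary[of z p]
      by (cases z) (auto simp: admissible_def unit_square_def)
  qed (simp add: p)
  have "v z = trial p z" for z
  proof (cases "z \<in> unit_square")
    case True
    then show ?thesis
      using affine_on_mesh_eqI[OF triangles_cover U(2) trial_affine nodes] by (simp add: trial_def)
  next
    case False
    then show ?thesis using extensional_arb[OF U(1) False] by (simp add: trial_def)
  qed
  then show "v \<in> range trial" by (intro range_eqI[of _ _ p] ext) simp
qed

lemma inj_trial: "trial p = trial p' \<Longrightarrow> p = p'"
proof -
  assume eq: "trial p = trial p'"
  have "\<phi> (p - p') z = 0" if "z \<in> open_unit_square" for z
    using fun_cong[OF eq, of z] that open_unit_square_subset by (auto simp: trial_def shape_diff)
  then show ?thesis using shape_eq_0[of "p - p'"] by simp
qed

lemma Lq_norm_trial: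
  assumes "\<forall>z\<in>open_unit_square. u z = 1"
  shows "Lq_norm q (\<lambda>z. u z - trial p z) = cost q p powr (1 / q)"
proof -
  have "(LINT z:open_unit_square|lborel. \<bar>u z - trial p z\<bar> powr q) = cost q p"
    unfolding cost_def
    using assms open_unit_square_subset
    by (intro set_lebesgue_integral_cong) (auto simp: trial_eq subset_iff)
  then show ?thesis by (simp add: Lq_norm_def)
qed

lemma cost_nonneg: "0 \<le> cost q p"
  unfolding cost_def set_lebesgue_integral_def by (intro Bochner_Integration.integral_nonneg) simp

lemma solutions_eq:
  assumes "\<forall>z\<in>open_unit_square. u z = 1" "1 \<le> q"
  shows "solutions u M q = trial ` {p. minimiser q p}"
proof -
  have mono: "cost q p powr (1/q) \<le> cost q p' powr (1/q) \<longleftrightarrow> cost q p \<le> cost q p'" for p p'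
    using assms(2) cost_nonneg[of q p] cost_nonneg[of q p']
      powr_less_mono2[of "1/q" "cost q p'" "cost q p"] powr_mono2[of "1/q" "cost q p" "cost q p'"]
    by force
  have "solutions u M q = {v \<in> range trial. \<forall>w\<in>range trial.
      Lq_norm q (\<lambda>z. u z - v z) \<le> Lq_norm q (\<lambda>z. u z - w z)}"
    unfolding solutions_def is_arg_min_def admissible_eq not_ex by (auto simp: not_less)
  then show ?thesis
    by (auto simp: Lq_norm_trial[OF assms(1)] minimiser_def mono)
qed

lemma unique_solution:
  assumes "\<forall>z\<in>open_unit_square. u z = 1" "1 < q" "minimiser q p"
  shows "solutions u M q = {trial p}"
proof -
  have "solutions u M q = trial ` {p. minimiser q p}"
    using assms(1,2) by (intro solutions_eq) simp_all
  then show ?thesis using minimiser_unique[OF assms(2) _ assms(3)] assms(3) by blast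
qed

end

section \<open>Shape functions of the four meshes\<close>

text \<open>The nodal function of the centre: on the square it is twice the distance to the boundary.\<close>

definition pyramid :: "real \<times> real \<Rightarrow> real" where
  "pyramid z = 2 * min (min (fst z) (1 - fst z)) (min (snd z) (1 - snd z))"

text \<open>On each triangle one of the four distances to the sides is smallest. It is enough to check this
  at the vertices of the triangle.\<close>

lemma pyramid_affine: "affine_on_mesh mesh1 pyramid"
proof -
  have dominated: "affine_fun_on (convex hull T) pyramid"
    if "f \<in> {fst, \<lambda>z. 1 - fst z, snd, \<lambda>z. 1 - snd z}"
      and "\<forall>z\<in>T. f z \<le> fst z" "\<forall>z\<in>T. f z \<le> 1 - fst z" "\<forall>z\<in>T. f z \<le> snd z" "\<forall>z\<in>T. f z \<le> 1 - snd z"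
    for f T
  proof (rule affine_fun_on_cong)
    have f: "affine_fun_on (convex hull T) f" using that(1) by auto
    then show "affine_fun_on (convex hull T) (\<lambda>z. 2 * f z)" by (rule affine_fun_on_mult_left)
    fix z assume z: "z \<in> convex hull T"
    have le: "f z \<le> g z" if "affine_fun_on (convex hull T) g" "\<forall>z\<in>T. f z \<le> g z" for g
      by (rule affine_fun_on_hull_le[OF f that z])
    have "f z \<le> fst z" "f z \<le> 1 - fst z" "f z \<le> snd z" "f z \<le> 1 - snd z"
      using le[OF _ that(2)] le[OF _ that(3)] le[OF _ that(4)] le[OF _ that(5)]
        affine_fun_on_diff[OF affine_fun_on_const affine_fun_on_fst]
        affine_fun_on_diff[OF affine_fun_on_const affine_fun_on_snd]
      by (simp_all add: affine_fun_on_fst affine_fun_on_snd)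
    then show "pyramid z = 2 * f z" using that(1) by (auto simp: pyramid_def min_def)
  qed
  show ?thesis
    unfolding affine_on_mesh_def mesh1_def
  proof (intro ballI, elim insertE emptyE; hypsubst)
    show "affine_fun_on (convex hull {(0, 0), (1, 0), (1/2, 1/2)}) pyramid"
      by (rule dominated[of snd]) auto
    show "affine_fun_on (convex hull {(1, 0), (1, 1), (1/2, 1/2)}) pyramid"
      by (rule dominated[of "\<lambda>z. 1 - fst z"]) auto
    show "affine_fun_on (convex hull {(1, 1), (0, 1), (1/2, 1/2)}) pyramid"
      by (rule dominated[of "\<lambda>z. 1 - snd z"]) auto
    show "affine_fun_on (convex hull {(0, 1), (0, 0), (1/2, 1/2)}) pyramid"
      by (rule dominated[of fst]) auto
  qed
qed

interpretation mesh1: mesh_shape_functions "\<lambda>a z. a * pyramid z" mesh1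
proof
  show "continuous_on UNIV (\<lambda>z. p * pyramid z)" for p
    unfolding pyramid_def by (intro continuous_intros)
  show "p = 0" if "\<And>z. z \<in> open_unit_square \<Longrightarrow> p * pyramid z = 0" for p
    using that[of "(1/2, 1/2)"] by (simp add: open_unit_square_def pyramid_def)
  show "\<Union>mesh1 \<subseteq> unit_square" by (auto simp: mesh1_def unit_square_def)
  show "unit_square \<subseteq> (\<Union>T\<in>mesh1. convex hull T)" by (rule mesh1_covers)
  show "affine_on_mesh mesh1 (\<lambda>z. p * pyramid z)" for p
    using pyramid_affine unfolding affine_on_mesh_def by (auto intro!: affine_fun_on_mult_left)
  show "p * pyramid z = 0" if "z \<in> unit_square" "fst z = 0 \<or> fst z = 1" for p z
    using that by (auto simp: unit_square_def pyramid_def min_def)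
  show "\<exists>p. \<forall>z\<in>free_nodes mesh1. p * pyramid z = f z" for f
    unfolding free_nodes_mesh1 by (rule exI[of _ "f (1/2, 1/2)"]) (simp add: pyramid_def)
qed (auto intro!: linearI simp: algebra_simps)

text \<open>In coordinates scaled by 2 and centred at the node \<open>(1/2, c)\<close>, the union of the triangles around
  the node is, within the square, the unit ball of a norm \<open>N\<close>: a square, a diamond or a hexagon,
  depending on the diagonals. The nodal function is the cone over that ball.\<close>

definition hat :: "(real \<Rightarrow> real \<Rightarrow> real) \<Rightarrow> real \<Rightarrow> real \<times> real \<Rightarrow> real" where
  "hat N c z = max 0 (1 - N (2 * fst z - 1) (2 * snd z - 2 * c))"

definition max_norm :: "real \<Rightarrow> real \<Rightarrow> real" where
  "max_norm s t = max \<bar>s\<bar> \<bar>t\<bar>"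

definition sum_norm :: "real \<Rightarrow> real \<Rightarrow> real" where
  "sum_norm s t = \<bar>s\<bar> + \<bar>t\<bar>"

text \<open>This equals \<open>max \<bar>s\<bar> (max \<bar>t\<bar> \<bar>s - t\<bar>)\<close>, the norm whose unit ball is the hexagon with vertices
  \<open>\<plusminus>(1, 0)\<close>, \<open>\<plusminus>(0, 1)\<close>, \<open>\<plusminus>(1, 1)\<close>. Unlike the maximum, whose inner comparison can change within a triangle,
  the sum needs only the signs of \<open>s\<close>, \<open>t\<close> and \<open>s - t\<close>, which are constant on every triangle.\<close>

definition hex_norm :: "real \<Rightarrow> real \<Rightarrow> real" where
  "hex_norm s t = 1/2 * (\<bar>s\<bar> + \<bar>t\<bar> + \<bar>s - t\<bar>)"

definition three_hats ::
  "(real \<Rightarrow> real \<Rightarrow> real) \<Rightarrow> (real \<Rightarrow> real \<Rightarrow> real) \<Rightarrow> real \<times> real \<times> real \<Rightarrow> real \<times> real \<Rightarrow> real" where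
  "three_hats N_out N_mid p z =
     fst p * hat N_out 0 z + fst (snd p) * hat N_mid (1/2) z + snd (snd p) * hat N_out 1 z"

text \<open>What is needed of a norm for its cones to be nodal functions: the first condition on values makes the
  hats vanish on the sides \<open>x = 0\<close> and \<open>x = 1\<close>, the second one normalises them on the midline, which contains
  all free nodes.\<close>

definition node_norm :: "(real \<Rightarrow> real \<Rightarrow> real) \<Rightarrow> bool" where
  "node_norm N \<longleftrightarrow> continuous_on UNIV (\<lambda>(s, t). N s t) \<and> (\<forall>s t. \<bar>s\<bar> \<le> N s t) \<and> (\<forall>t. N 0 t = \<bar>t\<bar>)"

lemma node_norm_max: "node_norm max_norm"
  by (auto simp: node_norm_def max_norm_def case_prod_beta intro!: continuous_intros)

lemma node_norm_sum: "node_norm sum_norm"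
  by (auto simp: node_norm_def sum_norm_def case_prod_beta intro!: continuous_intros)

lemma node_norm_hex: "node_norm hex_norm"
  by (auto simp: node_norm_def hex_norm_def case_prod_beta intro!: continuous_intros)

lemma hat_on_midline: "node_norm N \<Longrightarrow> hat N c (1/2, y) = max 0 (1 - \<bar>2 * y - 2 * c\<bar>)"
  by (simp add: hat_def node_norm_def)

lemma hat_boundary: "node_norm N \<Longrightarrow> fst z = 0 \<or> fst z = 1 \<Longrightarrow> hat N c z = 0"
  unfolding node_norm_def hat_def by (elim conjE disjE) (smt (verit))+

lemma continuous_on_hat:
  assumes "node_norm N"
  shows "continuous_on UNIV (hat N c)"
proof -
  have "continuous_on UNIV (\<lambda>(s, t). N s t)" using assms by (simp add: node_norm_def)
  then have "continuous_on UNIV (\<lambda>z. (\<lambda>(s, t). N s t) (2 * fst z - 1, 2 * snd z - 2 * c))"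
    by (rule continuous_on_compose2) (auto intro!: continuous_intros)
  then show ?thesis unfolding hat_def by (intro continuous_intros) simp
qed

text \<open>On the midline \<open>x = 1/2\<close> the hats are the usual one-dimensional ones. Three points of it already
  show their linear independence.\<close>

lemma mesh_shape_functions_three_hats:
  assumes "node_norm N_out" "node_norm N_mid"
    and "free_nodes M = {(1/2, 0), (1/2, 1/2), (1/2, 1)}"
    and "\<Union>M \<subseteq> unit_square" "unit_square \<subseteq> (\<Union>T\<in>M. convex hull T)"
    and aff: "affine_on_mesh M (hat N_out 0)" "affine_on_mesh M (hat N_mid (1/2))" "affine_on_mesh M (hat N_out 1)"
  shows "mesh_shape_functions (three_hats N_out N_mid) M"
proof
  note midline = hat_on_midline[OF assms(1)] hat_on_midline[OF assms(2)]
  show "continuous_on UNIV (three_hats N_out N_mid p)" for p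
    unfolding three_hats_def[abs_def] by (intro continuous_intros continuous_on_hat assms(1,2))
  show "p = 0" if "\<And>z. z \<in> open_unit_square \<Longrightarrow> three_hats N_out N_mid p z = 0" for p
    using that[of "(1/2, 1/2)"] that[of "(1/2, 1/4)"] that[of "(1/2, 3/4)"]
    by (cases p) (simp add: open_unit_square_def three_hats_def midline zero_prod_def)
  show "affine_on_mesh M (three_hats N_out N_mid p)" for p
    using aff unfolding three_hats_def[abs_def] affine_on_mesh_def
    by (intro ballI affine_fun_on_add affine_fun_on_mult_left) auto
  show "three_hats N_out N_mid p z = 0" if "fst z = 0 \<or> fst z = 1" for p z
    using hat_boundary[OF assms(1) that] hat_boundary[OF assms(2) that] by (simp add: three_hats_def)
  show "\<exists>p. \<forall>z\<in>free_nodes M. three_hats N_out N_mid p z = f z" for f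
    unfolding assms(3)
    by (rule exI[of _ "(f (1/2, 0), f (1/2, 1/2), f (1/2, 1))"]) (simp add: three_hats_def midline)
qed (use assms(4,5) in \<open>auto simp: three_hats_def algebra_simps\<close>)

lemmas affine_hull_intros =
  affine_fun_on_const affine_fun_on_fst affine_fun_on_snd affine_fun_on_add affine_fun_on_diff
  affine_fun_on_mult_left affine_fun_on_hull_max affine_fun_on_hull_abs

lemma mesh2_hats_affine:
  assumes "c \<in> {0, 1/2, 1}"
  shows "affine_on_mesh mesh2 (hat hex_norm c)"
  using assms
  unfolding affine_on_mesh_def mesh2_def cut_up_def hat_def[abs_def] hex_norm_def
  by (intro ballI, elim UnE insertE emptyE; hypsubst; intro affine_hull_intros; simp)

lemma mesh3_hats_affine:
  "affine_on_mesh mesh3 (hat sum_norm 0)" "affine_on_mesh mesh3 (hat max_norm (1/2))"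
  "affine_on_mesh mesh3 (hat sum_norm 1)"
  unfolding affine_on_mesh_def mesh3_def cut_up_def cut_down_def hat_def[abs_def] max_norm_def sum_norm_def
  by (intro ballI, elim UnE insertE emptyE; hypsubst; intro affine_hull_intros; simp)+

lemma mesh4_hats_affine:
  "affine_on_mesh mesh4 (hat max_norm 0)" "affine_on_mesh mesh4 (hat sum_norm (1/2))"
  "affine_on_mesh mesh4 (hat max_norm 1)"
  unfolding affine_on_mesh_def mesh4_def cut_up_def cut_down_def hat_def[abs_def] max_norm_def sum_norm_def
  by (intro ballI, elim UnE insertE emptyE; hypsubst; intro affine_hull_intros; simp)+

section \<open>Integrals of powers over an interval\<close>

lemma has_integral_half_interval:
  fixes K :: "real \<Rightarrow> real"
  assumes "(K has_integral I) {0..1}"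
  shows "((\<lambda>x. K (2 * (x - a))) has_integral I / 2) {a..a + 1/2}"
    and "((\<lambda>x. K (2 * (a + 1/2 - x))) has_integral I / 2) {a..a + 1/2}"
proof -
  have im1: "(\<lambda>x. (1/2) * x + a) ` {0..1} = {a..a + 1/2}"
    by (subst image_affinity_atLeastAtMost) auto
  have im2: "(\<lambda>x. (-1/2) * x + (a + 1/2)) ` {0..1} = {a..a + 1/2}"
    by (subst image_affinity_atLeastAtMost) auto
  show "((\<lambda>x. K (2 * (x - a))) has_integral I / 2) {a..a + 1/2}"
    using has_integral_affinity[of K I 0 1 2 "- 2 * a"] assms im1 by (simp add: algebra_simps)
  show "((\<lambda>x. K (2 * (a + 1/2 - x))) has_integral I / 2) {a..a + 1/2}"
    using has_integral_affinity[of K I 0 1 "-2" "2 * a + 1"] assms im2 by (simp add: algebra_simps)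
qed

lemma DERIV_abs_powr:
  assumes "x \<noteq> 0"
  shows "((\<lambda>x. \<bar>x\<bar> powr r) has_real_derivative r * pow_deriv r x) (at x)"
proof (cases "0 < x")
  case True
  have "((\<lambda>x. x powr r) has_real_derivative r * pow_deriv r x) (at x)"
    using has_real_derivative_powr[OF True, of r] True by (simp add: pow_deriv_def)
  then show ?thesis
    by (rule has_field_derivative_transform_within_open[where S = "{0<..}"]) (use True in auto)
next
  case False
  then have x: "0 < - x" using assms by simp
  have "((\<lambda>x. (- x) powr r) has_real_derivative r * pow_deriv r x) (at x)"
    using DERIV_chain2[OF has_real_derivative_powr[OF x, of r] DERIV_minus[OF DERIV_ident]] x
    by (simp add: pow_deriv_def)
  then show ?thesis
    by (rule has_field_derivative_transform_within_open[where S = "{..<0}"]) (use x in auto)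
qed

lemma pow_deriv_times: "pow_deriv r x * x = \<bar>x\<bar> powr r"
proof (cases "x = 0")
  case False
  have "pow_deriv r x * x = \<bar>x\<bar> powr (r - 1) * \<bar>x\<bar>"
    by (simp add: pow_deriv_def abs_sgn mult.assoc mult.commute)
  also have "\<dots> = \<bar>x\<bar> powr r" using False powr_add[of "\<bar>x\<bar>" "r - 1" 1] by simp
  finally show ?thesis .
qed (simp add: pow_deriv_def)

lemma pow_deriv_times_square: "pow_deriv q x * x\<^sup>2 = pow_deriv (q + 2) x"
proof (cases "x = 0")
  case False
  have "\<bar>x\<bar> powr (1 + q) = \<bar>x\<bar> powr (q - 1) * \<bar>x\<bar> powr 2"
    using powr_add[of "\<bar>x\<bar>" "q - 1" 2] by (simp add: add.commute)
  also have "\<bar>x\<bar> powr 2 = x\<^sup>2" using False by simp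
  finally show ?thesis by (simp add: pow_deriv_def)
qed (simp add: pow_deriv_def)

lemma DERIV_signed_powr:
  assumes "x \<noteq> 0"
  shows "((\<lambda>x. x * \<bar>x\<bar> powr r) has_real_derivative (r + 1) * \<bar>x\<bar> powr r) (at x)"
  using DERIV_mult[OF DERIV_ident DERIV_abs_powr[OF assms, of r]] pow_deriv_times[of r x]
  by (simp add: algebra_simps)

lemma FTC_off_point:
  fixes F f :: "real \<Rightarrow> real"
  assumes "a \<le> b" "continuous_on UNIV F" "\<And>x. x \<noteq> c \<Longrightarrow> (F has_real_derivative f x) (at x)"
  shows "(f has_integral (F b - F a)) {a..b}"
  using assms
  by (intro fundamental_theorem_of_calculus_interior_strong[of "{c}"])
    (auto simp flip: has_real_derivative_iff_has_vector_derivative intro: continuous_on_subset)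

lemma has_integral_pow_deriv:
  assumes "1 \<le> q" "0 < k" "l \<le> r"
  shows "((\<lambda>x. pow_deriv q (k * x - m)) has_integral
    (\<bar>k * r - m\<bar> powr q - \<bar>k * l - m\<bar> powr q) / (k * q)) {l..r}"
proof -
  have "((\<lambda>x. pow_deriv q (k * x - m)) has_integral
      \<bar>k * r - m\<bar> powr q / (k * q) - \<bar>k * l - m\<bar> powr q / (k * q)) {l..r}"
  proof (rule FTC_off_point[where c = "m / k"])
    show "continuous_on UNIV (\<lambda>x. \<bar>k * x - m\<bar> powr q / (k * q))"
      using assms by (intro continuous_intros) auto
    fix x assume "x \<noteq> m / k"
    then have "k * x - m \<noteq> 0" using assms by (simp add: field_simps)
    from DERIV_abs_powr[OF this, of q]
    have "((\<lambda>x. \<bar>k * x - m\<bar> powr q) has_real_derivative q * pow_deriv q (k * x - m) * k) (at x)"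
      by (rule DERIV_chain2) (auto intro!: derivative_eq_intros)
    from DERIV_cdivide[OF this, of "k * q"]
    show "((\<lambda>x. \<bar>k * x - m\<bar> powr q / (k * q)) has_real_derivative pow_deriv q (k * x - m)) (at x)"
      using assms by (simp add: mult.commute)
  qed (use assms in simp)
  then show ?thesis by (simp add: diff_divide_distrib)
qed

text \<open>The substitution \<open>w = 1 - a t\<close>. The kink of the power at \<open>w = 0\<close> is the reason to admit an antiderivative \<open>H\<close>
  that is merely continuous there.\<close>

lemma has_integral_affine_argument:
  fixes H h :: "real \<Rightarrow> real"
  assumes "0 < a" "continuous_on UNIV H" "\<And>w. w \<noteq> 0 \<Longrightarrow> (H has_real_derivative h w) (at w)"
  shows "((\<lambda>t. h (1 - a * t)) has_integral (H 1 - H (1 - a)) / a) {0..1}"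
proof -
  have "((\<lambda>t. h (1 - a * t)) has_integral (- H (1 - a * 1) / a - (- H (1 - a * 0) / a))) {0..1}"
  proof (rule FTC_off_point[where c = "1 / a"])
    show "continuous_on UNIV (\<lambda>t. - H (1 - a * t) / a)"
      using assms(1) by (intro continuous_intros continuous_on_compose2[OF assms(2)]) auto
    fix t assume "t \<noteq> 1 / a"
    then have "1 - a * t \<noteq> 0" using assms(1) by (simp add: field_simps)
    from assms(3)[OF this]
    have "((\<lambda>t. H (1 - a * t)) has_real_derivative h (1 - a * t) * (- a)) (at t)"
      by (rule DERIV_chain2) (auto intro!: derivative_eq_intros)
    from DERIV_cdivide[OF DERIV_minus[OF this], of a]
    show "((\<lambda>t. - H (1 - a * t) / a) has_real_derivative h (1 - a * t)) (at t)"
      using assms(1) by simp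
  qed simp
  then show ?thesis by (simp add: diff_divide_distrib)
qed

lemma powr_shift:
  assumes "0 < (b::real)"
  shows "b powr q = b * b powr (q - 1)" "b powr (q + 2) = b^3 * b powr (q - 1)"
proof -
  show "b powr q = b * b powr (q - 1)" using assms powr_add[of b 1 "q - 1"] by simp
  have "b powr 3 = b^3" using powr_realpow[OF assms, of 3] by simp
  then show "b powr (q + 2) = b^3 * b powr (q - 1)"
    using powr_add[of b 3 "q - 1"] by (simp add: algebra_simps)
qed

lemma DERIV_abs_powr_add_2:
  assumes "w \<noteq> 0" "0 < q"
  shows "((\<lambda>w. \<bar>w\<bar> powr (q + 2) / (q + 2)) has_real_derivative \<bar>w\<bar> powr q * w) (at w)"
proof -
  have "pow_deriv (q + 2) w = \<bar>w\<bar> powr q * w"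
    using pow_deriv_times[of q w] by (simp flip: pow_deriv_times_square add: power2_eq_square mult.assoc)
  then show ?thesis
    using DERIV_cdivide[OF DERIV_abs_powr[OF assms(1), of "q + 2"], of "q + 2"] assms(2) by simp
qed

lemma DERIV_signed_powr_div:
  assumes "w \<noteq> 0" "0 < q"
  shows "((\<lambda>w. w * \<bar>w\<bar> powr q / (q + 1)) has_real_derivative \<bar>w\<bar> powr q) (at w)"
  using DERIV_cdivide[OF DERIV_signed_powr[OF assms(1), of q], of "q + 1"] assms(2) by simp

lemma DERIV_abs_powr_div:
  assumes "w \<noteq> 0" "0 < q"
  shows "((\<lambda>w. \<bar>w\<bar> powr q / q) has_real_derivative pow_deriv q w) (at w)"
  using DERIV_cdivide[OF DERIV_abs_powr[OF assms(1), of q], of q] assms(2) by simp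

text \<open>The four elementary integrals from which the optimality conditions for Meshes 1 and 2 are assembled. The letter
  \<open>Q\<close> stands for the only transcendental quantity that they contain.\<close>

context
  fixes q a b Q :: real
  assumes q: "1 \<le> q" and a: "1 < a"
  defines "b \<equiv> a - 1" and "Q \<equiv> (a - 1) powr (q - 1)"
begin

lemma b_powr: "\<bar>b\<bar> powr q = b * Q" "\<bar>b\<bar> powr (q + 2) = b^3 * Q"
  using powr_shift[of "a - 1" q] a by (simp_all add: b_def Q_def)

lemma minus_b: "1 - a = - b"
  by (simp add: b_def)

lemma integral_pow_deriv_parabola:
  "((\<lambda>t. pow_deriv q (1 - a * t) * (t * (1 - t))) has_integral
     ((b/q + (1 - b)/(q + 1) - 1/(q + 2)) - Q * (b\<^sup>2/q - (1 - b) * b\<^sup>2/(q + 1) - b^3/(q + 2))) / a^3) {0..1}"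
proof -
  define H where "H w = (b * (\<bar>w\<bar> powr q / q) + (1 - b) * (w * \<bar>w\<bar> powr q / (q + 1)) - \<bar>w\<bar> powr (q + 2) / (q + 2)) / a\<^sup>2" for w
  define h where "h w = (b * pow_deriv q w + (1 - b) * \<bar>w\<bar> powr q - \<bar>w\<bar> powr q * w) / a\<^sup>2" for w
  have "((\<lambda>t. h (1 - a * t)) has_integral (H 1 - H (1 - a)) / a) {0..1}"
  proof (rule has_integral_affine_argument)
    show "continuous_on UNIV H" unfolding H_def using q a by (intro continuous_intros) auto
    show "(H has_real_derivative h w) (at w)" if "w \<noteq> 0" for w
      unfolding H_def h_def using q that
      by (intro DERIV_cdivide DERIV_diff DERIV_add DERIV_cmult DERIV_abs_powr_add_2
          DERIV_signed_powr_div DERIV_abs_powr_div) auto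
  qed (use a in simp)
  moreover have "h (1 - a * t) = pow_deriv q (1 - a * t) * (t * (1 - t))" for t
    using a by (simp add: h_def b_def flip: pow_deriv_times) (simp add: field_simps power2_eq_square)
  moreover have "(H 1 - H (1 - a)) / a =
      ((b/q + (1 - b)/(q + 1) - 1/(q + 2)) - Q * (b\<^sup>2/q - (1 - b) * b\<^sup>2/(q + 1) - b^3/(q + 2))) / a^3"
  proof -
    have "H 1 = (b/q + (1 - b)/(q + 1) - 1/(q + 2)) / a\<^sup>2" by (simp add: H_def)
    moreover have "H (1 - a) = (Q * (b\<^sup>2/q - (1 - b) * b\<^sup>2/(q + 1) - b^3/(q + 2))) / a\<^sup>2"
      unfolding H_def minus_b by (simp add: b_powr algebra_simps power2_eq_square power3_eq_cube)
    ultimately show ?thesis by (simp add: power3_eq_cube power2_eq_square flip: diff_divide_distrib)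
  qed
  ultimately show ?thesis by simp
qed

lemma integral_times_abs_powr:
  "((\<lambda>t. t * \<bar>1 - a * t\<bar> powr q) has_integral
     (1/(q + 1) - 1/(q + 2) + Q * (b\<^sup>2/(q + 1) + b^3/(q + 2))) / a\<^sup>2) {0..1}"
proof -
  define H where "H w = (w * \<bar>w\<bar> powr q / (q + 1) - \<bar>w\<bar> powr (q + 2) / (q + 2)) / a" for w
  define h where "h w = (\<bar>w\<bar> powr q - \<bar>w\<bar> powr q * w) / a" for w
  have "((\<lambda>t. h (1 - a * t)) has_integral (H 1 - H (1 - a)) / a) {0..1}"
  proof (rule has_integral_affine_argument)
    show "continuous_on UNIV H" unfolding H_def using q a by (intro continuous_intros) auto
    show "(H has_real_derivative h w) (at w)" if "w \<noteq> 0" for w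
      unfolding H_def h_def using q that
      by (intro DERIV_cdivide DERIV_diff DERIV_abs_powr_add_2 DERIV_signed_powr_div) auto
  qed (use a in simp)
  moreover have "h (1 - a * t) = t * \<bar>1 - a * t\<bar> powr q" for t
    using a by (simp add: h_def field_simps)
  moreover have "(H 1 - H (1 - a)) / a = (1/(q + 1) - 1/(q + 2) + Q * (b\<^sup>2/(q + 1) + b^3/(q + 2))) / a\<^sup>2"
  proof -
    have "H 1 = (1/(q + 1) - 1/(q + 2)) / a" by (simp add: H_def)
    moreover have "H (1 - a) = - (Q * (b\<^sup>2/(q + 1) + b^3/(q + 2))) / a"
      unfolding H_def minus_b by (simp add: b_powr algebra_simps power2_eq_square)
    ultimately show ?thesis by (simp add: power2_eq_square flip: diff_divide_distrib add_divide_distrib)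
  qed
  ultimately show ?thesis by simp
qed

lemma integral_pow_deriv_linear_parabola:
  "((\<lambda>t. pow_deriv q (- b * t) * (t * (1 - t))) has_integral - Q * (1/(q + 1) - 1/(q + 2))) {0..1}"
proof -
  let ?F = "\<lambda>t. - Q * (t * \<bar>t\<bar> powr q / (q + 1) - \<bar>t\<bar> powr (q + 2) / (q + 2))"
  have "((\<lambda>t. - Q * (\<bar>t\<bar> powr q - \<bar>t\<bar> powr q * t)) has_integral ?F 1 - ?F 0) {0..1}"
    using q by (intro FTC_off_point[where c = 0] continuous_intros DERIV_cmult DERIV_diff
        DERIV_abs_powr_add_2 DERIV_signed_powr_div) auto
  moreover have "- Q * (\<bar>t\<bar> powr q - \<bar>t\<bar> powr q * t) = pow_deriv q (- b * t) * (t * (1 - t))" for t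
  proof -
    have "pow_deriv q (- b * t) = - Q * pow_deriv q t"
      using a by (simp add: pow_deriv_def b_def Q_def abs_mult powr_mult sgn_mult)
    then show ?thesis by (simp flip: pow_deriv_times) (simp add: algebra_simps)
  qed
  ultimately show ?thesis by simp
qed

lemma integral_times_abs_powr_linear:
  "((\<lambda>t. t * \<bar>b * t\<bar> powr q) has_integral b * Q / (q + 2)) {0..1}"
proof -
  let ?F = "\<lambda>t. b * Q * (\<bar>t\<bar> powr (q + 2) / (q + 2))"
  have "((\<lambda>t. b * Q * (\<bar>t\<bar> powr q * t)) has_integral ?F 1 - ?F 0) {0..1}"
    using q by (intro FTC_off_point[where c = 0] continuous_intros DERIV_cmult DERIV_abs_powr_add_2) auto
  moreover have "b * Q * (\<bar>t\<bar> powr q * t) = t * \<bar>b * t\<bar> powr q" for t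
    using a powr_shift(1)[of b q] by (simp add: b_def Q_def abs_mult powr_mult)
  ultimately show ?thesis by simp
qed

section \<open>The optimal central value on Mesh 1\<close>

text \<open>After integration over \<open>x\<close>, the slice of the bottom or top triangle at height \<open>s/2\<close> from its side
  contributes the values of \<open>\<bar>e\<bar>\<^sup>q / q\<close> at its end points, weighted by the value \<open>s\<close> of the pyramid.\<close>

lemma integral_bottom_slices:
  "((\<lambda>s. s * (\<bar>1 - a * s\<bar> powr q - \<bar>b * s\<bar> powr q) / q) has_integral
     ((1/(q + 1) - 1/(q + 2) + Q * (b\<^sup>2/(q + 1) + b^3/(q + 2))) / a\<^sup>2 - b * Q / (q + 2)) / q) {0..1}"
  using has_integral_divide[OF has_integral_diff[OF integral_times_abs_powr integral_times_abs_powr_linear], of q]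
  by (simp add: algebra_simps)

text \<open>The contributions of the left, the right, and the bottom and top triangles add up to the stated
  equation.\<close>

lemma mesh1_orthogonality_algebra:
  "- Q * (1/(q + 1) - 1/(q + 2)) / 2
   + ((b/q + (1 - b)/(q + 1) - 1/(q + 2)) - Q * (b\<^sup>2/q - (1 - b) * b\<^sup>2/(q + 1) - b^3/(q + 2))) / a^3 / 2
   + 2 * (((1/(q + 1) - 1/(q + 2) + Q * (b\<^sup>2/(q + 1) + b^3/(q + 2))) / a\<^sup>2 - b * Q / (q + 2)) / q / 2)
   = - (Q * (4 * a^3 * q + 4 * (1 - q) * a\<^sup>2 + (q - 6) * a + 2) - a * (q + 4) + 2)
     / (2 * q * (q + 1) * (q + 2) * a^3)"
proof -
  have nz: "q \<noteq> 0" "q + 1 \<noteq> 0" "q + 2 \<noteq> 0" "a \<noteq> 0" using q a by auto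
  show ?thesis
    using nz unfolding b_def
    by (simp add: divide_simps) algebra
qed

text \<open>The derivative of the cost with respect to the central value \<open>a\<close> is \<open>-q\<close> times this integral. With
  \<open>t\<close> the value of the pyramid, the error is \<open>-b t\<close> on the left triangle \<open>L\<close> and \<open>1 - a t\<close> on the right
  triangle \<open>R\<close>, so that both reduce to one dimension. On the bottom \<open>D\<close> and the top \<open>U\<close> the pyramid depends on
  \<open>y\<close> only, and the integral over \<open>x\<close> is explicit.\<close>

lemma mesh1_orthogonality:
  "(LINT z:open_unit_square|lborel. pow_deriv q (mesh1.err (a - 1/2) z) * pyramid z) =
    - (Q * (4 * a^3 * q + 4 * (1 - q) * a\<^sup>2 + (q - 6) * a + 2) - a * (q + 4) + 2)
     / (2 * q * (q + 1) * (q + 2) * a^3)"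
proof -
  let ?e = "mesh1.err (a - 1/2)"
  let ?f = "\<lambda>z. pow_deriv q (?e z) * pyramid z"
  define L where "L = {z :: real \<times> real. 0 < fst z \<and> fst z < 1/2 \<and> fst z < snd z \<and> snd z < 1 - fst z}"
  define R where "R = {z :: real \<times> real. 1/2 < fst z \<and> fst z < 1 \<and> 1 - fst z < snd z \<and> snd z < fst z}"
  define D where "D = {z :: real \<times> real. 0 < snd z \<and> snd z < 1/2 \<and> snd z < fst z \<and> fst z < 1 - snd z}"
  define U where "U = {z :: real \<times> real. 1/2 < snd z \<and> snd z < 1 \<and> 1 - snd z < fst z \<and> fst z < snd z}"
  have cont_pyr: "continuous_on UNIV pyramid"
    unfolding pyramid_def[abs_def] by (intro continuous_intros)
  have cont_e: "continuous_on UNIV ?e"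
    using mesh1.continuous_on_err[of UNIV "\<lambda>z. z"] by simp
  note [measurable] = borel_measurable_continuous_onI[OF cont_pyr] borel_measurable_continuous_onI[OF cont_e]
  have f_meas: "?f \<in> borel_measurable borel" by measurable
  obtain B1 where B1: "\<And>z. z \<in> unit_square \<Longrightarrow> \<bar>?e z\<bar> \<le> B1"
    using bounded_on_unit_square[OF cont_e] by blast
  obtain B2 where B2: "\<And>z. z \<in> unit_square \<Longrightarrow> \<bar>pyramid z\<bar> \<le> B2"
    using bounded_on_unit_square[OF cont_pyr] by blast
  have bound: "\<bar>?f z\<bar> \<le> B1 powr (q - 1) * B2" if "z \<in> unit_square" for z
    unfolding abs_mult using B1[OF that] B2[OF that] abs_pow_deriv_le[OF q, of "?e z" B1]
    by (intro mult_mono) auto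
  have pyr_L: "pyramid (x, y) = 2 * x" if "0 < x" "x < 1/2" "x \<le> y" "y \<le> 1 - x" for x y
    using that by (simp add: pyramid_def min_def)
  have pyr_R: "pyramid (x, y) = 2 * (1 - x)" if "1/2 < x" "x < 1" "1 - x \<le> y" "y \<le> x" for x y
    using that by (simp add: pyramid_def min_def)
  have pyr_D: "pyramid (x, y) = 2 * y" if "0 < y" "y < 1/2" "y \<le> x" "x \<le> 1 - y" for x y
    using that by (simp add: pyramid_def min_def)
  have pyr_U: "pyramid (x, y) = 2 * (1 - y)" if "1/2 < y" "y < 1" "1 - y \<le> x" "x \<le> y" for x y
    using that by (simp add: pyramid_def min_def)
  have sub: "L \<subseteq> unit_square" "R \<subseteq> unit_square" "D \<subseteq> unit_square" "U \<subseteq> unit_square"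
    by (auto simp: L_def R_def D_def U_def unit_square_def)
  have const: "((\<lambda>y. c) has_integral (r - l) * c) {l..r}" if "l \<le> r" for c l r :: real
    using has_integral_const_real[of c l r] that by simp

  have int_L: "(LINT z:L|lborel. ?f z) = - Q * (1/(q + 1) - 1/(q + 2)) / 2"
  proof (rule integral_vertical_slices[OF f_meas _ _ L_def sub(1) bound])
    fix x :: real assume x: "0 < x" "x < 1/2"
    have "((\<lambda>y. ?f (x, y)) has_integral (1 - x - x) * (pow_deriv q (- b * (2 * x)) * (2 * x))) {x..1 - x}"
    proof (rule has_integral_eq[OF _ const])
      fix y assume "y \<in> {x..1 - x}"
      then show "pow_deriv q (- b * (2 * x)) * (2 * x) = ?f (x, y)"
        using x by (simp add: pyr_L mesh1.err_def b_def algebra_simps)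
    qed (use x in simp)
    then show "((\<lambda>y. ?f (x, y)) has_integral pow_deriv q (- b * (2 * (x - 0))) * (2 * (x - 0) * (1 - 2 * (x - 0)))) {x..1 - x}"
      by (simp add: algebra_simps)
  next
    show "((\<lambda>x. pow_deriv q (- b * (2 * (x - 0))) * (2 * (x - 0) * (1 - 2 * (x - 0)))) has_integral
        - Q * (1/(q + 1) - 1/(q + 2)) / 2) {0..1/2}"
      using has_integral_half_interval(1)[OF integral_pow_deriv_linear_parabola, of 0] by simp
  qed (use sub in auto)

  have int_R: "(LINT z:R|lborel. ?f z) =
    ((b/q + (1 - b)/(q + 1) - 1/(q + 2)) - Q * (b\<^sup>2/q - (1 - b) * b\<^sup>2/(q + 1) - b^3/(q + 2))) / a^3 / 2"
  proof (rule integral_vertical_slices[OF f_meas _ _ R_def sub(2) bound])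
    fix x :: real assume x: "1/2 < x" "x < 1"
    have "((\<lambda>y. ?f (x, y)) has_integral (x - (1 - x)) * (pow_deriv q (1 - a * (2 * (1 - x))) * (2 * (1 - x)))) {1 - x..x}"
    proof (rule has_integral_eq[OF _ const])
      fix y assume "y \<in> {1 - x..x}"
      then show "pow_deriv q (1 - a * (2 * (1 - x))) * (2 * (1 - x)) = ?f (x, y)"
        using x by (simp add: pyr_R mesh1.err_def algebra_simps)
    qed (use x in simp)
    then show "((\<lambda>y. ?f (x, y)) has_integral pow_deriv q (1 - a * (2 * (1/2 + 1/2 - x))) * (2 * (1/2 + 1/2 - x) * (1 - 2 * (1/2 + 1/2 - x)))) {1 - x..x}"
      by (simp add: algebra_simps)
  next
    show "((\<lambda>x. pow_deriv q (1 - a * (2 * (1/2 + 1/2 - x))) * (2 * (1/2 + 1/2 - x) * (1 - 2 * (1/2 + 1/2 - x)))) has_integral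
      ((b/q + (1 - b)/(q + 1) - 1/(q + 2)) - Q * (b\<^sup>2/q - (1 - b) * b\<^sup>2/(q + 1) - b^3/(q + 2))) / a^3 / 2) {1/2..1}"
      using has_integral_half_interval(2)[OF integral_pow_deriv_parabola, of "1/2"] by simp
  qed (use sub in auto)

  have slice: "((\<lambda>x. pow_deriv q (x - (2 * a - 1) * (s / 2)) * s) has_integral
      s * (\<bar>1 - a * s\<bar> powr q - \<bar>b * s\<bar> powr q) / q) {s / 2..1 - s / 2}" if "0 \<le> s" "s \<le> 1" for s
  proof -
    have ends: "1 * (1 - s / 2) - (2 * a - 1) * (s / 2) = 1 - a * s"
      "1 * (s / 2) - (2 * a - 1) * (s / 2) = - (b * s)"
      by (simp_all add: b_def algebra_simps)
    have "s / 2 \<le> 1 - s / 2" using that by simp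
    from has_integral_mult_left[OF has_integral_pow_deriv[OF q zero_less_one this, of "(2 * a - 1) * (s / 2)"], of s]
    show ?thesis unfolding ends by (simp only: mult_1 abs_minus times_divide_eq_right mult.commute[of _ s])
  qed

  have int_D: "(LINT z:D|lborel. ?f z) =
    ((1/(q + 1) - 1/(q + 2) + Q * (b\<^sup>2/(q + 1) + b^3/(q + 2))) / a\<^sup>2 - b * Q / (q + 2)) / q / 2"
  proof (rule integral_horizontal_slices[OF f_meas _ _ D_def sub(3) bound])
    fix y :: real assume y: "0 < y" "y < 1/2"
    let ?s = "2 * (y - 0)"
    have "((\<lambda>x. ?f (x, y)) has_integral ?s * (\<bar>1 - a * ?s\<bar> powr q - \<bar>b * ?s\<bar> powr q) / q) {?s / 2..1 - ?s / 2}"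
    proof (rule has_integral_eq[OF _ slice])
      fix x assume "x \<in> {?s / 2..1 - ?s / 2}"
      then show "pow_deriv q (x - (2 * a - 1) * (?s / 2)) * ?s = ?f (x, y)"
        using y by (simp add: pyr_D mesh1.err_def algebra_simps)
    qed (use y in simp_all)
    then show "((\<lambda>x. ?f (x, y)) has_integral ?s * (\<bar>1 - a * ?s\<bar> powr q - \<bar>b * ?s\<bar> powr q) / q) {y..1 - y}"
      by simp
  next
    show "((\<lambda>y. 2 * (y - 0) * (\<bar>1 - a * (2 * (y - 0))\<bar> powr q - \<bar>b * (2 * (y - 0))\<bar> powr q) / q) has_integral
      ((1/(q + 1) - 1/(q + 2) + Q * (b\<^sup>2/(q + 1) + b^3/(q + 2))) / a\<^sup>2 - b * Q / (q + 2)) / q / 2) {0..1/2}"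
      using has_integral_half_interval(1)[OF integral_bottom_slices, of 0] by simp
  qed (use sub in auto)

  have int_U: "(LINT z:U|lborel. ?f z) =
    ((1/(q + 1) - 1/(q + 2) + Q * (b\<^sup>2/(q + 1) + b^3/(q + 2))) / a\<^sup>2 - b * Q / (q + 2)) / q / 2"
  proof (rule integral_horizontal_slices[OF f_meas _ _ U_def sub(4) bound])
    fix y :: real assume y: "1/2 < y" "y < 1"
    let ?s = "2 * (1/2 + 1/2 - y)"
    have "((\<lambda>x. ?f (x, y)) has_integral ?s * (\<bar>1 - a * ?s\<bar> powr q - \<bar>b * ?s\<bar> powr q) / q) {?s / 2..1 - ?s / 2}"
    proof (rule has_integral_eq[OF _ slice])
      fix x assume "x \<in> {?s / 2..1 - ?s / 2}"
      then have "1 - y \<le> x" "x \<le> y" by (simp_all add: field_simps)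
      then have pyr: "pyramid (x, y) = ?s" using pyr_U[OF y] by simp
      have "?e (x, y) = x - (2 * a - 1) * (?s / 2)"
        unfolding mesh1.err_def pyr by (simp add: field_simps)
      then show "pow_deriv q (x - (2 * a - 1) * (?s / 2)) * ?s = ?f (x, y)" by (simp only: pyr)
    qed (use y in simp_all)
    moreover have "?s / 2 = 1 - y" "1 - ?s / 2 = y" by (simp_all add: field_simps)
    ultimately show "((\<lambda>x. ?f (x, y)) has_integral ?s * (\<bar>1 - a * ?s\<bar> powr q - \<bar>b * ?s\<bar> powr q) / q) {1 - y..y}"
      by (simp only:)
  next
    show "((\<lambda>y. 2 * (1/2 + 1/2 - y) * (\<bar>1 - a * (2 * (1/2 + 1/2 - y))\<bar> powr q - \<bar>b * (2 * (1/2 + 1/2 - y))\<bar> powr q) / q) has_integral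
      ((1/(q + 1) - 1/(q + 2) + Q * (b\<^sup>2/(q + 1) + b^3/(q + 2))) / a\<^sup>2 - b * Q / (q + 2)) / q / 2) {1/2..1}"
      using has_integral_half_interval(2)[OF integral_bottom_slices, of "1/2"] by simp
  qed (use sub in auto)

  have meas: "T \<in> sets borel" if "T \<in> {L, R, D, U}" for T
  proof -
    have "open T"
      using that by (elim insertE emptyE; simp add: L_def R_def D_def U_def)
        (intro open_Collect_conj open_Collect_less continuous_intros)+
    then show ?thesis by simp
  qed
  have split: "(LINT z:open_unit_square|lborel. ?f z) = (\<Sum>T\<leftarrow>[L, R, D, U]. LINT z:T|lborel. ?f z)"
  proof (rule set_integral_split)
    show "set_integrable lborel T ?f" if "T \<in> set [L, R, D, U]" for T
      using that sub by (intro set_integrable_bounded_square[OF _ _ f_meas bound] meas) auto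
    have "AE z in (lborel :: (real \<times> real) measure). 1 * fst z + (-1) * snd z \<noteq> 0"
      "AE z in (lborel :: (real \<times> real) measure). 1 * fst z + 1 * snd z \<noteq> 1"
      by (intro AE_off_line; simp)+
    then show "AE z in lborel. indicat_real open_unit_square z = (\<Sum>T\<leftarrow>[L, R, D, U]. indicat_real T z)"
      by eventually_elim
        (auto simp: indicator_def L_def R_def D_def U_def open_unit_square_def mem_Times_iff)
  qed (use meas f_meas in auto)
  have "(LINT z:open_unit_square|lborel. ?f z) = l + r + 2 * d"
    if "(LINT z:L|lborel. ?f z) = l" "(LINT z:R|lborel. ?f z) = r"
      "(LINT z:D|lborel. ?f z) = d" "(LINT z:U|lborel. ?f z) = d" for l r d
    unfolding split using that by simp
  from this[OF int_L int_R int_D int_U] show ?thesis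
    unfolding mesh1_orthogonality_algebra .
qed

end

text \<open>Beyond 1 the cubic is strictly increasing, because
  \<open>p y - p x = (y - x) (c3 (x\<^sup>2 + x y + y\<^sup>2) - c1)\<close>.\<close>

lemma cubic_root_bounds:
  fixes \<alpha> c0 c1 c3 lo hi :: real
  defines "p \<equiv> \<lambda>x. c3 * x^3 - c1 * x + c0"
  assumes "0 \<le> c3" "c1 < 3 * c3" "1 < \<alpha>" "p \<alpha> = 0" "1 < lo" "1 < hi" "p lo < 0" "0 < p hi"
  shows "lo < \<alpha>" "\<alpha> < hi"
proof -
  have mono: "p x < p y" if "1 < x" "x < y" for x y
  proof -
    have "1 * 1 < x * x" "1 * 1 < x * y" "1 * 1 < y * y" using that by (intro mult_strict_mono; simp)+
    then have "c3 * 3 \<le> c3 * (x * x + x * y + y * y)" using assms(2) by (intro mult_left_mono) auto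
    then have "0 < (y - x) * (c3 * (x * x + x * y + y * y) - c1)"
      using that assms(3) by (intro mult_pos_pos) auto
    also have "\<dots> = p y - p x" by (simp add: p_def algebra_simps power3_eq_cube)
    finally show ?thesis by simp
  qed
  show "lo < \<alpha>" using mono[of \<alpha> lo] assms by (cases \<alpha> lo rule: linorder_cases) auto
  show "\<alpha> < hi" using mono[of hi \<alpha>] assms by (cases \<alpha> hi rule: linorder_cases) auto
qed

definition overshoot_residual :: "real \<Rightarrow> real \<Rightarrow> real" where
  "overshoot_residual q a =
     (a - 1) powr (q - 1) * (4 * a^3 * q + 4 * (1 - q) * a^2 + (q - 6) * a + 2) - a * (q + 4) + 2"

lemma overshoot_residual_1: "1 < a \<Longrightarrow> overshoot_residual 1 a = 2 * (2 * a^3 - 5 * a + 2)"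
  by (simp add: overshoot_residual_def)

text \<open>At \<open>a = 1\<close> the residual is \<open>- q - 2\<close>, since the power vanishes for \<open>q > 1\<close>; at \<open>a = 2\<close> it is \<open>16 q\<close>.\<close>

lemma overshoot_residual_root:
  assumes "1 < q"
  shows "\<exists>a>1. overshoot_residual q a = 0"
proof -
  have "continuous_on {1..2} (overshoot_residual q)"
    unfolding overshoot_residual_def[abs_def] using assms
    by (intro continuous_intros continuous_on_powr') auto
  moreover have "overshoot_residual q 1 \<le> 0" "0 \<le> overshoot_residual q 2"
    using assms by (simp_all add: overshoot_residual_def)
  ultimately obtain a where a: "1 \<le> a" "overshoot_residual q a = 0"
    using IVT'[of "overshoot_residual q" 1 0 2] by auto
  moreover have "a \<noteq> 1" using a(2) assms by (auto simp: overshoot_residual_def)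
  ultimately show ?thesis by (intro exI[of _ a]) auto
qed

lemma mesh1_minimiser:
  assumes q: "1 \<le> q" and a: "1 < a" and root: "overshoot_residual q a = 0"
  shows "mesh1.minimiser q (a - 1/2)"
proof -
  let ?e = "mesh1.err (a - 1/2)"
  have cont_e: "continuous_on UNIV ?e"
    using mesh1.continuous_on_err[of UNIV "\<lambda>z. z"] by simp
  obtain B where B: "\<And>z. z \<in> unit_square \<Longrightarrow> \<bar>?e z\<bar> \<le> B"
    using bounded_on_unit_square[OF cont_e] by blast
  show ?thesis
  proof (rule mesh1.minimiser_if_orthogonal[OF q])
    show "(\<lambda>z. pow_deriv q (?e z)) \<in> borel_measurable borel"
      using borel_measurable_continuous_onI[OF cont_e] by measurable
    show "\<bar>pow_deriv q (?e z)\<bar> \<le> B powr (q - 1)" if "z \<in> open_unit_square" for z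
      using that open_unit_square_subset by (intro abs_pow_deriv_le q B) auto
    show "\<bar>?e z\<bar> powr q + q * pow_deriv q (?e z) * (y - ?e z) \<le> \<bar>y\<bar> powr q" for z y
      by (rule abs_powr_ge_tangent[OF q])
    have zero: "(LINT z:open_unit_square|lborel. pow_deriv q (?e z) * pyramid z) = 0"
      unfolding mesh1_orthogonality[OF q a] using root by (simp add: overshoot_residual_def)
    have "(LINT z:open_unit_square|lborel. pow_deriv q (?e z) * (d * pyramid z)) =
        d * (LINT z:open_unit_square|lborel. pow_deriv q (?e z) * pyramid z)" for d
      unfolding set_integral_mult_right[symmetric] by (simp add: algebra_simps)
    with zero show "(LINT z:open_unit_square|lborel. pow_deriv q (?e z) * (d * pyramid z)) = 0" for d
      by simp
  qed
qed

lemma mesh1_trial_centre: "mesh1.trial p (1/2, 1/2) = p + 1/2"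
proof -
  have "pyramid (1/2, 1/2) = 1" by (simp add: pyramid_def)
  then show ?thesis by (simp add: mesh1.trial_def unit_square_def)
qed

text \<open>In the right triangle the error of the central value \<open>s\<close> at pyramid height \<open>t\<close> is \<open>1 - s t\<close>. If a
  second minimiser had central value \<open>c\<close> different from \<open>a\<close>, the two errors would have opposite signs for \<open>1/t\<close>
  halfway between \<open>a\<close> and \<open>max c 1\<close>; the maximum keeps \<open>t < 1\<close>.\<close>

lemma mesh1_L1_minimiser_unique:
  assumes "1 < a" "mesh1.minimiser 1 (a - 1/2)" "mesh1.minimiser 1 p"
  shows "p = a - 1/2"
proof (rule ccontr)
  define c where "c = p + 1/2"
  define t where "t = 2 / (a + max c 1)"
  assume "p \<noteq> a - 1/2"
  then have "c \<noteq> a" by (simp add: c_def)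
  have t: "0 < t" "t < 1" using assms(1) by (auto simp: t_def max_def)
  have err: "mesh1.err (s - 1/2) (1 - t / 2, 1/2) = 1 - s * t" for s
  proof -
    have "pyramid (1 - t / 2, 1/2) = t" using t by (simp add: pyramid_def min_def)
    then show ?thesis by (simp add: mesh1.err_def algebra_simps)
  qed
  have "0 \<le> mesh1.err (a - 1/2) (1 - t / 2, 1/2) * mesh1.err p (1 - t / 2, 1/2)"
    using assms(2,3) t by (intro mesh1.minimisers_same_sign) (auto simp: unit_square_def)
  then have sign: "0 \<le> (1 - a * t) * (1 - c * t)"
    using err[of a] err[of c] by (simp add: c_def)
  have "a * t \<noteq> 1" "c * t \<noteq> 1" "(a * t < 1) = (1 < c * t)"
    using assms(1) \<open>c \<noteq> a\<close> by (auto simp: t_def field_simps max_def split: if_splits)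
  with sign show False by (auto simp: zero_le_mult_iff)
qed

lemma mesh1_solutions:
  assumes "\<forall>z\<in>open_unit_square. u z = 1" "1 \<le> q" "1 < a" "overshoot_residual q a = 0"
  shows "\<exists>v. solutions u mesh1 q = {v} \<and> v (1/2, 1/2) = a"
proof -
  have min: "mesh1.minimiser q (a - 1/2)" using assms by (intro mesh1_minimiser)
  have "p = a - 1/2" if "mesh1.minimiser q p" for p
    using mesh1_L1_minimiser_unique[OF assms(3), of p] mesh1.minimiser_unique[of q p "a - 1/2"] min that assms(2)
    by (cases "q = 1") auto
  with min have "{p. mesh1.minimiser q p} = {a - 1/2}" by blast
  then have "solutions u mesh1 q = {mesh1.trial (a - 1/2)}"
    using mesh1.solutions_eq[OF assms(1,2)] by simp
  then show ?thesis using mesh1_trial_centre[of "a - 1/2"] by auto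
qed

section \<open>Three free nodes on the midline\<close>

context shape_functions
begin

text \<open>With all values on the midline equal to \<open>1 + t\<close> the approximant depends on \<open>x\<close> only. The error is
  \<open>-2 t x\<close> in the left half of the square and \<open>1 - (1 + t) (2 - 2 x)\<close> in the right half.\<close>

lemma cost_ridge:
  assumes q: "0 < q" and t: "0 \<le> t"
    and ridge: "\<And>z. z \<in> unit_square \<Longrightarrow> \<phi> p z = (1/2 + t) * (1 - \<bar>2 * fst z - 1\<bar>)"
  shows "cost q p = (t powr q + (1 + t * t powr q) / (1 + t)) / (q + 1) / 2"
proof -
  let ?c = "1 + t"
  have left: "((\<lambda>x. \<bar>2 * t * x\<bar> powr q) has_integral t powr q / (q + 1) / 2) {0..1/2}"
  proof -
    have "((\<lambda>s. \<bar>t * s\<bar> powr q) has_integral t powr q / (q + 1)) {0..1}"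
    proof -
      let ?F = "\<lambda>s. t powr q * (s * \<bar>s\<bar> powr q / (q + 1))"
      have "((\<lambda>s. t powr q * \<bar>s\<bar> powr q) has_integral ?F 1 - ?F 0) {0..1}"
        using q by (intro FTC_off_point[where c = 0] continuous_intros DERIV_cmult DERIV_signed_powr_div) auto
      then show ?thesis using t by (simp add: abs_mult powr_mult)
    qed
    from has_integral_half_interval(1)[OF this, of 0] show ?thesis by (simp add: algebra_simps)
  qed
  have right: "((\<lambda>x. \<bar>1 - ?c * (2 * (1 - x))\<bar> powr q) has_integral
      (1 + t * t powr q) / ?c / (q + 1) / 2) {1/2..1}"
  proof -
    let ?H = "\<lambda>w. w * \<bar>w\<bar> powr q / (q + 1)"
    have "((\<lambda>s. \<bar>1 - ?c * s\<bar> powr q) has_integral (?H 1 - ?H (1 - ?c)) / ?c) {0..1}"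
      using q t by (intro has_integral_affine_argument continuous_intros DERIV_signed_powr_div) auto
    moreover have "(?H 1 - ?H (1 - ?c)) / ?c = (1 + t * t powr q) / ?c / (q + 1)"
      using t q by (simp add: add_divide_distrib mult.commute)
    ultimately have "((\<lambda>s. \<bar>1 - ?c * s\<bar> powr q) has_integral (1 + t * t powr q) / ?c / (q + 1)) {0..1}"
      by simp
    from has_integral_half_interval(2)[OF this, of "1/2"] show ?thesis by (simp add: mult.commute)
  qed
  let ?g = "\<lambda>x. \<bar>x - (1/2 + t) * (1 - \<bar>2 * x - 1\<bar>)\<bar> powr q"
  have "(?g has_integral t powr q / (q + 1) / 2) {0..1/2}"
  proof (rule has_integral_eq[OF _ left])
    fix x :: real assume "x \<in> {0..1/2}"
    then have "\<bar>2 * x - 1\<bar> = 1 - 2 * x" by auto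
    then have eq: "x - (1/2 + t) * (1 - \<bar>2 * x - 1\<bar>) = - (2 * t * x)" by (simp add: field_simps)
    show "\<bar>2 * t * x\<bar> powr q = ?g x" unfolding eq by simp
  qed
  moreover have "(?g has_integral (1 + t * t powr q) / ?c / (q + 1) / 2) {1/2..1}"
    by (rule has_integral_eq[OF _ right]) (auto simp: abs_if algebra_simps)
  ultimately have outer: "(?g has_integral t powr q / (q + 1) / 2 + (1 + t * t powr q) / ?c / (q + 1) / 2) {0..1}"
    by (rule has_integral_combine[rotated 2]) auto
  have cont_g: "continuous_on UNIV (\<lambda>z :: real \<times> real. ?g (fst z))"
    using q by (intro continuous_intros)
  obtain B where B: "\<And>z. z \<in> unit_square \<Longrightarrow> \<bar>?g (fst z)\<bar> \<le> B"
    using bounded_on_unit_square[OF cont_g] by blast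
  have "cost q p = (LINT z:open_unit_square|lborel. ?g (fst z))"
    unfolding cost_def using open_unit_square_subset
    by (intro set_lebesgue_integral_cong) (auto simp: err_def ridge subset_iff)
  also have "\<dots> = t powr q / (q + 1) / 2 + (1 + t * t powr q) / ?c / (q + 1) / 2"
  proof (rule integral_vertical_slices[where l = "\<lambda>_. 0" and u = "\<lambda>_. 1", OF _ _ _ _ open_unit_square_subset _ _ outer])
    show "(\<lambda>z :: real \<times> real. ?g (fst z)) \<in> borel_measurable borel"
      by (rule borel_measurable_continuous_onI[OF cont_g])
    show "open_unit_square = {z. 0 < fst z \<and> fst z < 1 \<and> 0 < snd z \<and> snd z < 1}"
      by (auto simp: open_unit_square_def)
    show "\<bar>?g (fst z)\<bar> \<le> B" if "z \<in> open_unit_square" for z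
      using that open_unit_square_subset by (intro B) auto
    show "((\<lambda>y :: real. ?g (fst (x, y))) has_integral ?g x) {0..1}" for x
      using has_integral_const_real[of "?g x" 0 1] by simp
  qed auto
  finally show ?thesis by (simp add: add_divide_distrib)
qed

text \<open>By the explicit cost, the values \<open>1 + t\<close> are better than 1 if and only if \<open>t\<^bsup>q-1\<^esup> (1 + 2 t) < 1\<close>,
  which holds for all small positive \<open>t\<close>.\<close>

lemma ridge_not_minimiser:
  assumes q: "1 < q"
    and ridge: "\<And>s z. z \<in> unit_square \<Longrightarrow> \<phi> (P s) z = s * (1 - \<bar>2 * fst z - 1\<bar>)"
  shows "\<not> minimiser q (P (1/2))"
proof -
  \<comment> \<open>Chosen such that \<open>t\<^bsup>q-1\<^esup> = (1/2)\<^sup>q < 1/2\<close>, while \<open>1 + 2 t < 2\<close>.\<close>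
  define t where "t = (1/2 :: real) powr (q / (q - 1))"
  have t: "0 < t" "t < 1/2"
    using q powr_less_mono'[of "1/2 :: real" 1 "q / (q - 1)"] by (auto simp: t_def field_simps)
  have "t powr (q - 1) = (1/2) powr q" using q by (simp add: t_def powr_powr)
  also have "\<dots> < (1/2) powr 1" using q by (intro powr_less_mono') auto
  finally have "t powr (q - 1) * (1 + 2 * t) < (1/2) * 2"
    using t by (intro mult_strict_mono) auto
  moreover have "t powr q = t * t powr (q - 1)" using powr_shift(1)[of t q] t by simp
  ultimately have "t powr q * (1 + 2 * t) < t" using t by (simp add: mult.assoc)
  then have "t powr q + (1 + t * t powr q) / (1 + t) < 1"
    using t by (simp add: field_simps)
  then have "cost q (P (1/2 + t)) < cost q (P (1/2))"
    using cost_ridge[of q t "P (1/2 + t)"] cost_ridge[of q 0 "P (1/2)"] ridge q t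
    by (simp add: divide_strict_right_mono)
  then show ?thesis by (auto simp: minimiser_def not_le)
qed

end

lemma three_hats_nodes:
  assumes "node_norm N_out" "node_norm N_mid"
  shows "three_hats N_out N_mid p (1/2, 0) = fst p"
    and "three_hats N_out N_mid p (1/2, 1/2) = fst (snd p)"
    and "three_hats N_out N_mid p (1/2, 1) = snd (snd p)"
  by (simp_all add: three_hats_def hat_on_midline[OF assms(1)] hat_on_midline[OF assms(2)])

text \<open>The last assumption makes the sum of the three hats computable: it is the ridge
  \<open>1 - \<bar>2 x - 1\<bar>\<close> on every such mesh, whatever the diagonals are.\<close>

locale three_hats_mesh = mesh_shape_functions "three_hats N_out N_mid" M
  for N_out N_mid :: "real \<Rightarrow> real \<Rightarrow> real" and M +
  assumes norms: "node_norm N_out" "node_norm N_mid"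
    and nodes: "free_nodes M = {(1/2, 0), (1/2, 1/2), (1/2, 1)}"
    and ridge_affine: "affine_on_mesh M (\<lambda>z. \<bar>2 * fst z - 1\<bar>)"
begin

lemma trial_nodes:
  "trial p (1/2, 0) = 1/2 + fst p" "trial p (1/2, 1/2) = 1/2 + fst (snd p)" "trial p (1/2, 1) = 1/2 + snd (snd p)"
  by (simp_all add: trial_def unit_square_def three_hats_nodes[OF norms])

lemma ridge:
  assumes "z \<in> unit_square"
  shows "three_hats N_out N_mid (s, s, s) z = s * (1 - \<bar>2 * fst z - 1\<bar>)"
proof (rule affine_on_mesh_eqI[OF triangles_cover shape_affine _ _ assms])
  show "affine_on_mesh M (\<lambda>z. s * (1 - \<bar>2 * fst z - 1\<bar>))"
    using ridge_affine unfolding affine_on_mesh_def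
    by (auto intro!: affine_fun_on_mult_left affine_fun_on_diff)
  show "three_hats N_out N_mid (s, s, s) z = s * (1 - \<bar>2 * fst z - 1\<bar>)" if "z \<in> \<Union>M" for z
  proof (cases "z \<in> free_nodes M")
    case True
    then show ?thesis unfolding nodes by (auto simp: three_hats_nodes[OF norms])
  next
    case False
    then have "fst z = 0 \<or> fst z = 1" using that by (auto simp: free_nodes_def)
    then show ?thesis using shape_boundary[of z] that vertices_in_square by auto
  qed
qed

lemma unique_solution_overshoots:
  assumes u: "\<forall>z\<in>open_unit_square. u z = 1" and q: "1 < q"
  shows "\<exists>v. solutions u M q = {v} \<and> over_or_undershoots M v"
proof -
  obtain p where p: "minimiser q p" using minimiser_exists[of q] q by auto
  have "over_or_undershoots M (trial p)"
    unfolding over_or_undershoots_def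
  proof
    assume "\<forall>z\<in>free_nodes M. trial p z = 1"
    then have "p = (1/2, 1/2, 1/2)"
      unfolding nodes by (cases p) (simp add: trial_nodes)
    then show False using p ridge_not_minimiser[OF q, of "\<lambda>s. (s, s, s)"] ridge by simp
  qed
  moreover have "solutions u M q = {trial p}" using u q p by (intro unique_solution)
  ultimately show ?thesis by blast
qed

text \<open>The error is 0 to the left of the midline and \<open>2 x - 1\<close> to the right of it, so the sign of \<open>2 x - 1\<close>
  is a subgradient everywhere. It is odd under the reflection \<open>x \<mapsto> 1 - x\<close>, and the hats are even.\<close>

lemma ridge_minimiser_if_symmetric:
  assumes sym: "\<And>s t. N_out (- s) t = N_out s t" "\<And>s t. N_mid (- s) t = N_mid s t"
  shows "minimiser 1 (1/2, 1/2, 1/2)"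
proof (rule minimiser_if_orthogonal[OF order_refl, where B = 1])
  let ?w = "\<lambda>z :: real \<times> real. sgn (2 * fst z - 1)"
  have "(\<lambda>z :: real \<times> real. 2 * fst z - 1) \<in> borel_measurable borel"
    by (intro borel_measurable_continuous_onI continuous_intros)
  then show w_meas: "?w \<in> borel_measurable borel" by measurable
  show w_bound: "\<bar>?w z\<bar> \<le> 1" for z by (simp add: sgn_if)
  show "\<bar>err (1/2, 1/2, 1/2) z\<bar> powr 1 + 1 * ?w z * (y - err (1/2, 1/2, 1/2) z) \<le> \<bar>y\<bar> powr 1"
    if "z \<in> open_unit_square" for z y
  proof -
    have "err (1/2, 1/2, 1/2) z = max 0 (2 * fst z - 1)"
      using that open_unit_square_subset ridge[of z "1/2"] by (auto simp: err_def max_def abs_if field_simps)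
    then show ?thesis by (auto simp: sgn_if max_def)
  qed
  fix d
  let ?\<phi> = "three_hats N_out N_mid d"
  obtain C where C: "\<And>z. z \<in> unit_square \<Longrightarrow> \<bar>?\<phi> z\<bar> \<le> C"
    using bounded_on_unit_square[OF continuous_shape] by blast
  have mirror: "hat N c (1 - x, y) = hat N c (x, y)" if "\<And>s t. N (- s) t = N s t" for N c x y
    using that[of "2 * x - 1"] by (simp add: hat_def)
  show "(LINT z:open_unit_square|lborel. ?w z * ?\<phi> z) = 0"
  proof (rule antisymmetric_integral_zero[where B = "1 * C"])
    show "(\<lambda>z. ?w z * ?\<phi> z) \<in> borel_measurable borel"
      using w_meas borel_measurable_continuous_onI[OF continuous_shape] by measurable
    show "\<bar>?w z * ?\<phi> z\<bar> \<le> 1 * C" if "z \<in> open_unit_square" for z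
      unfolding abs_mult using C[of z] that open_unit_square_subset w_bound by (intro mult_mono) auto
    show "?w (1 - x, y) * ?\<phi> (1 - x, y) = - (?w (x, y) * ?\<phi> (x, y))" for x y
    proof -
      have "?\<phi> (1 - x, y) = ?\<phi> (x, y)"
        by (simp add: three_hats_def mirror sym)
      moreover have "?w (1 - x, y) = - ?w (x, y)" by (simp add: sgn_if)
      ultimately show ?thesis by simp
    qed
  qed
qed

end

lemma ridge_affine:
  "affine_on_mesh mesh2 (\<lambda>z. \<bar>2 * fst z - 1\<bar>)" "affine_on_mesh mesh3 (\<lambda>z. \<bar>2 * fst z - 1\<bar>)"
  "affine_on_mesh mesh4 (\<lambda>z. \<bar>2 * fst z - 1\<bar>)"
  unfolding affine_on_mesh_def mesh2_def mesh3_def mesh4_def cut_up_def cut_down_def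
  by (intro ballI, elim UnE insertE emptyE; hypsubst; intro affine_hull_intros; simp)+

interpretation mesh2: three_hats_mesh hex_norm hex_norm mesh2
  by (intro three_hats_mesh.intro three_hats_mesh_axioms.intro mesh_shape_functions_three_hats node_norm_hex
      free_nodes_mesh2 mesh2_covers mesh2_hats_affine ridge_affine)
    (auto simp: mesh2_def cut_up_def unit_square_def)

interpretation mesh3: three_hats_mesh sum_norm max_norm mesh3
  by (intro three_hats_mesh.intro three_hats_mesh_axioms.intro mesh_shape_functions_three_hats node_norm_sum node_norm_max
      free_nodes_mesh3 mesh3_covers mesh3_hats_affine ridge_affine)
    (auto simp: mesh3_def cut_up_def cut_down_def unit_square_def)

interpretation mesh4: three_hats_mesh max_norm sum_norm mesh4
  by (intro three_hats_mesh.intro three_hats_mesh_axioms.intro mesh_shape_functions_three_hats node_norm_sum node_norm_max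
      free_nodes_mesh4 mesh4_covers mesh4_hats_affine ridge_affine)
    (auto simp: mesh4_def cut_up_def cut_down_def unit_square_def)

section \<open>The \<open>L\<^sup>1\<close> problem on Mesh 2\<close>

text \<open>The open triangles into which \<open>cut_up a b\<close> divides the subsquare with lower left corner \<open>(a, b)\<close>.\<close>

definition lower_triangle :: "real \<Rightarrow> real \<Rightarrow> (real \<times> real) set" where
  "lower_triangle a b = {z. a < fst z \<and> fst z < a + 1/2 \<and> b < snd z \<and> snd z < b + (fst z - a)}"

definition upper_triangle :: "real \<Rightarrow> real \<Rightarrow> (real \<times> real) set" where
  "upper_triangle a b = {z. a < fst z \<and> fst z < a + 1/2 \<and> b + (fst z - a) < snd z \<and> snd z < b + 1/2}"

lemma triangles_subset_unit_square:
  assumes "a \<in> {0, 1/2}" "b \<in> {0, 1/2}"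
  shows "lower_triangle a b \<subseteq> unit_square" "upper_triangle a b \<subseteq> unit_square"
  using assms by (auto simp: lower_triangle_def upper_triangle_def unit_square_def)

lemma sets_triangles [measurable]:
  "lower_triangle a b \<in> sets borel" "upper_triangle a b \<in> sets borel"
proof -
  have "open (lower_triangle a b)" "open (upper_triangle a b)"
    unfolding lower_triangle_def upper_triangle_def
    by (intro open_Collect_conj open_Collect_less continuous_intros)+
  then show "lower_triangle a b \<in> sets borel" "upper_triangle a b \<in> sets borel" by simp_all
qed

lemma integral_affine_triangles:
  assumes "a \<in> {0, 1/2}" "b \<in> {0, 1/2}"
  shows "(LINT z:lower_triangle a b|lborel. A + B * (fst z - a) + C * (snd z - b)) = A / 8 + B / 24 + C / 48"
    and "(LINT z:upper_triangle a b|lborel. A + B * (fst z - a) + C * (snd z - b)) = A / 8 + B / 48 + C / 24"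
proof -
  let ?f = "\<lambda>z :: real \<times> real. A + B * (fst z - a) + C * (snd z - b)"
  have cont: "continuous_on UNIV ?f" by (intro continuous_intros)
  obtain K where K: "\<And>z. z \<in> unit_square \<Longrightarrow> \<bar>?f z\<bar> \<le> K"
    using bounded_on_unit_square[OF cont] by blast
  have inner: "((\<lambda>y. ?f (x, y)) has_integral
      (A + B * (x - a)) * (r - b) + C * (r - b)\<^sup>2 / 2 - ((A + B * (x - a)) * (l - b) + C * (l - b)\<^sup>2 / 2)) {l..r}"
    if "l \<le> r" for l r x
    using that
    by (intro FTC_off_point[where c = 0 and F = "\<lambda>y. (A + B * (x - a)) * (y - b) + C * (y - b)\<^sup>2 / 2"] continuous_intros)
      (auto intro!: derivative_eq_intros)
  show "(LINT z:lower_triangle a b|lborel. ?f z) = A / 8 + B / 24 + C / 48"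
  proof (rule integral_vertical_slices[OF borel_measurable_continuous_onI[OF cont] _ _ lower_triangle_def])
    show "((\<lambda>y. ?f (x, y)) has_integral (A + B * (x - a)) * (x - a) + C * (x - a)\<^sup>2 / 2) {b..b + (x - a)}" if "a < x" for x
      using inner[of b "b + (x - a)" x] that by simp
    let ?F = "\<lambda>x. A * (x - a)\<^sup>2 / 2 + B * (x - a)^3 / 3 + C * (x - a)^3 / 6"
    have "((\<lambda>x. (A + B * (x - a)) * (x - a) + C * (x - a)\<^sup>2 / 2) has_integral ?F (a + 1/2) - ?F a) {a..a + 1/2}"
      by (intro FTC_off_point[where c = 0] continuous_intros)
        (auto intro!: derivative_eq_intros
          simp: power2_eq_square algebra_simps add_divide_distrib diff_divide_distrib)
    then show "((\<lambda>x. (A + B * (x - a)) * (x - a) + C * (x - a)\<^sup>2 / 2) has_integral A / 8 + B / 24 + C / 48) {a..a + 1/2}"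
      by (simp add: power2_eq_square power3_eq_cube add_ac)
  qed (use triangles_subset_unit_square[OF assms] K in auto)
  show "(LINT z:upper_triangle a b|lborel. ?f z) = A / 8 + B / 48 + C / 24"
  proof (rule integral_vertical_slices[OF borel_measurable_continuous_onI[OF cont] _ _ upper_triangle_def])
    show "((\<lambda>y. ?f (x, y)) has_integral (A + B * (x - a)) * (1/2 - (x - a)) + C * (1/4 - (x - a)\<^sup>2) / 2)
        {b + (x - a)..b + 1/2}" if "x < a + 1/2" for x
      using inner[of "b + (x - a)" "b + 1/2" x] that by (simp add: field_simps power2_eq_square)
    let ?F = "\<lambda>x. A * (x - a) / 2 - A * (x - a)\<^sup>2 / 2 + B * (x - a)\<^sup>2 / 4 - B * (x - a)^3 / 3 + C * (x - a) / 8 - C * (x - a)^3 / 6"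
    have "((\<lambda>x. (A + B * (x - a)) * (1/2 - (x - a)) + C * (1/4 - (x - a)\<^sup>2) / 2) has_integral ?F (a + 1/2) - ?F a) {a..a + 1/2}"
      by (intro FTC_off_point[where c = 0] continuous_intros)
        (auto intro!: derivative_eq_intros
          simp: power2_eq_square algebra_simps add_divide_distrib diff_divide_distrib)
    then show "((\<lambda>x. (A + B * (x - a)) * (1/2 - (x - a)) + C * (1/4 - (x - a)\<^sup>2) / 2) has_integral A / 8 + B / 48 + C / 24) {a..a + 1/2}"
      by (simp add: power2_eq_square power3_eq_cube add_ac)
  qed (use triangles_subset_unit_square[OF assms] K in auto)
qed

lemma integral_eq_affine_lower:
  assumes "a \<in> {0, 1/2}" "b \<in> {0, 1/2}"
    and "\<And>z. z \<in> lower_triangle a b \<Longrightarrow> f z = A + B * (fst z - a) + C * (snd z - b)"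
  shows "(LINT z:lower_triangle a b|lborel. f z) = A / 8 + B / 24 + C / 48"
  unfolding integral_affine_triangles(1)[OF assms(1,2), symmetric]
  using assms(3) by (intro set_lebesgue_integral_cong) auto

lemma integral_eq_affine_upper:
  assumes "a \<in> {0, 1/2}" "b \<in> {0, 1/2}"
    and "\<And>z. z \<in> upper_triangle a b \<Longrightarrow> f z = A + B * (fst z - a) + C * (snd z - b)"
  shows "(LINT z:upper_triangle a b|lborel. f z) = A / 8 + B / 48 + C / 24"
  unfolding integral_affine_triangles(2)[OF assms(1,2), symmetric]
  using assms(3) by (intro set_lebesgue_integral_cong) auto

text \<open>Away from the edges, the indicators of the two triangles of a subsquare sum up to a product of two
  interval indicators, and the sum of the four products factorises.\<close>

lemma integral_square_triangles:
  fixes f :: "real \<times> real \<Rightarrow> real"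
  assumes "f \<in> borel_measurable borel" "\<And>z. z \<in> unit_square \<Longrightarrow> \<bar>f z\<bar> \<le> B"
  shows "(LINT z:open_unit_square|lborel. f z) =
    (\<Sum>T\<leftarrow>[lower_triangle 0 0, upper_triangle 0 0, lower_triangle (1/2) 0, upper_triangle (1/2) 0,
      lower_triangle 0 (1/2), upper_triangle 0 (1/2), lower_triangle (1/2) (1/2), upper_triangle (1/2) (1/2)].
      LINT z:T|lborel. f z)"
    (is "_ = (\<Sum>T\<leftarrow>?Ts. _)")
proof (rule set_integral_split)
  have sub: "T \<subseteq> unit_square" if "T \<in> set ?Ts" for T
    using that by (auto simp: lower_triangle_def upper_triangle_def unit_square_def)
  show meas: "T \<in> sets borel" if "T \<in> set ?Ts" for T
    using that by auto
  show "set_integrable lborel T f" if "T \<in> set ?Ts" for T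
    using sub[OF that] by (intro set_integrable_bounded_square[OF meas[OF that] _ assms]) auto
  have "AE z in (lborel :: (real \<times> real) measure). 1 * fst z + 0 * snd z \<noteq> 1/2"
    "AE z in (lborel :: (real \<times> real) measure). 0 * fst z + 1 * snd z \<noteq> 1/2"
    "AE z in (lborel :: (real \<times> real) measure). 1 * fst z + (-1) * snd z \<noteq> 0"
    "AE z in (lborel :: (real \<times> real) measure). 1 * fst z + (-1) * snd z \<noteq> 1/2"
    "AE z in (lborel :: (real \<times> real) measure). 1 * fst z + (-1) * snd z \<noteq> -1/2"
    by (intro AE_off_line; simp)+
  then show "AE z in lborel. indicat_real open_unit_square z = (\<Sum>T\<leftarrow>?Ts. indicat_real T z)"
  proof eventually_elim
    case (elim z)
    let ?I = "\<lambda>a :: real. indicat_real {a<..<a + 1/2}"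
    have pair: "indicat_real (lower_triangle a b) z + indicat_real (upper_triangle a b) z = ?I a (fst z) * ?I b (snd z)"
      if "snd z - b \<noteq> fst z - a" for a b
      using that by (auto simp: indicator_def lower_triangle_def upper_triangle_def)
    have halves: "?I 0 x + ?I (1/2) x = indicat_real {0<..<1} x" if "x \<noteq> 1/2" for x
      using that by (auto simp: indicator_def)
    have "(\<Sum>T\<leftarrow>?Ts. indicat_real T z) = (?I 0 (fst z) + ?I (1/2) (fst z)) * (?I 0 (snd z) + ?I (1/2) (snd z))"
      using pair[of 0 0] pair[of 0 "1/2"] pair[of "1/2" 0] pair[of "1/2" "1/2"] elim
      by (simp add: distrib_left distrib_right)
    also have "\<dots> = indicat_real {0<..<1} (fst z) * indicat_real {0<..<1} (snd z)"
      using halves[of "fst z"] halves[of "snd z"] elim by simp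
    also have "\<dots> = indicat_real open_unit_square z"
      by (auto simp: indicator_def open_unit_square_def mem_Times_iff)
    finally show ?case by simp
  qed
qed (use assms(1) in auto)

lemma hex_hats_on_triangles:
  "z \<in> lower_triangle 0 0 \<Longrightarrow> three_hats hex_norm hex_norm d z = 2 * fst d * (fst z - snd z) + 2 * fst (snd d) * snd z"
  "z \<in> upper_triangle 0 0 \<Longrightarrow> three_hats hex_norm hex_norm d z = 2 * fst (snd d) * fst z"
  "z \<in> lower_triangle (1/2) 0 \<Longrightarrow> three_hats hex_norm hex_norm d z = 2 * fst d * (1 - fst z)"
  "z \<in> upper_triangle (1/2) 0 \<Longrightarrow> three_hats hex_norm hex_norm d z =
     fst d * (1 - 2 * snd z) + fst (snd d) * (1 + 2 * snd z - 2 * fst z)"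
  "z \<in> lower_triangle 0 (1/2) \<Longrightarrow> three_hats hex_norm hex_norm d z =
     fst (snd d) * (1 + 2 * fst z - 2 * snd z) + snd (snd d) * (2 * snd z - 1)"
  "z \<in> upper_triangle 0 (1/2) \<Longrightarrow> three_hats hex_norm hex_norm d z = 2 * snd (snd d) * fst z"
  "z \<in> lower_triangle (1/2) (1/2) \<Longrightarrow> three_hats hex_norm hex_norm d z = 2 * fst (snd d) * (1 - fst z)"
  "z \<in> upper_triangle (1/2) (1/2) \<Longrightarrow> three_hats hex_norm hex_norm d z =
     2 * fst (snd d) * (1 - snd z) + 2 * snd (snd d) * (snd z - fst z)"
proof -
  have combine: "three_hats hex_norm hex_norm d z = fst d * h0 + fst (snd d) * h1 + snd (snd d) * h2"
    if "hat hex_norm 0 z = h0" "hat hex_norm (1/2) z = h1" "hat hex_norm 1 z = h2" for h0 h1 h2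
    using that by (simp add: three_hats_def)
  note defs = lower_triangle_def upper_triangle_def hat_def hex_norm_def
  show "three_hats hex_norm hex_norm d z = 2 * fst d * (fst z - snd z) + 2 * fst (snd d) * snd z"
    if "z \<in> lower_triangle 0 0"
    by (subst combine[of "2 * (fst z - snd z)" "2 * snd z" 0]) (use that in \<open>auto simp: defs field_simps\<close>)
  show "three_hats hex_norm hex_norm d z = 2 * fst (snd d) * fst z" if "z \<in> upper_triangle 0 0"
    by (subst combine[of 0 "2 * fst z" 0]) (use that in \<open>auto simp: defs field_simps\<close>)
  show "three_hats hex_norm hex_norm d z = 2 * fst d * (1 - fst z)" if "z \<in> lower_triangle (1/2) 0"
    by (subst combine[of "2 * (1 - fst z)" 0 0]) (use that in \<open>auto simp: defs field_simps\<close>)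
  show "three_hats hex_norm hex_norm d z = fst d * (1 - 2 * snd z) + fst (snd d) * (1 + 2 * snd z - 2 * fst z)"
    if "z \<in> upper_triangle (1/2) 0"
    by (subst combine[of "1 - 2 * snd z" "1 + 2 * snd z - 2 * fst z" 0]) (use that in \<open>auto simp: defs field_simps\<close>)
  show "three_hats hex_norm hex_norm d z =
      fst (snd d) * (1 + 2 * fst z - 2 * snd z) + snd (snd d) * (2 * snd z - 1)"
    if "z \<in> lower_triangle 0 (1/2)"
    by (subst combine[of 0 "1 + 2 * fst z - 2 * snd z" "2 * snd z - 1"]) (use that in \<open>auto simp: defs field_simps\<close>)
  show "three_hats hex_norm hex_norm d z = 2 * snd (snd d) * fst z" if "z \<in> upper_triangle 0 (1/2)"
    by (subst combine[of 0 0 "2 * fst z"]) (use that in \<open>auto simp: defs field_simps\<close>)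
  show "three_hats hex_norm hex_norm d z = 2 * fst (snd d) * (1 - fst z)"
    if "z \<in> lower_triangle (1/2) (1/2)"
    by (subst combine[of 0 "2 * (1 - fst z)" 0]) (use that in \<open>auto simp: defs field_simps\<close>)
  show "three_hats hex_norm hex_norm d z = 2 * fst (snd d) * (1 - snd z) + 2 * snd (snd d) * (snd z - fst z)"
    if "z \<in> upper_triangle (1/2) (1/2)"
    by (subst combine[of 0 "2 * (1 - snd z)" "2 * (snd z - fst z)"]) (use that in \<open>auto simp: defs field_simps\<close>)
qed

text \<open>With \<open>q = 1\<close> in the power integrals, the contributions of the two triangles of the lower right
  subsquare to the hat at \<open>(1/2, 0)\<close> have to balance that of the lower left one; this is the cubic.\<close>

lemma mesh2_orthogonality_algebra:
  fixes a b :: real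
  defines "b \<equiv> a - 1"
  assumes "1 < a" "3 * a^3 - 8 * a + 4 = 0"
  shows "((b + (1 - b) / 2 - 1/3) - (b\<^sup>2 - (1 - b) * b\<^sup>2 / 2 - b^3 / 3)) / a^3
    + ((1/2 - 1/3 + (b\<^sup>2 / 2 + b^3 / 3)) / a\<^sup>2 - b / 3) = 1 / 6"
proof -
  have "a \<noteq> 0" using assms(2) by simp
  then show ?thesis
    using assms(3) unfolding b_def by (simp add: divide_simps) algebra
qed

text \<open>The error is negative below the diagonal of the lower left subsquare, changes its sign on the two
  triangles of the lower right subsquare, is positive on the upper right subsquare, and vanishes on
  the three remaining triangles. On these \<open>w\<close> is free within \<open>[-1, 1]\<close>. The value -1 on the lower
  one of the two in the upper left subsquare and 0 on the upper one balance the hat at \<open>(1/2, 1)\<close>. The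
  constant \<open>r\<close> on the one in the lower left subsquare then balances the hat at \<open>(1/2, 1/2)\<close>, whose
  support meets just one triangle where the error changes sign; since all these triangles carry
  the same mass \<open>1/24\<close> of a nodal function, \<open>\<bar>r\<bar> \<le> 1\<close>.\<close>

lemma mesh2_minimiser:
  assumes a: "1 < a" and root: "3 * a^3 - 8 * a + 4 = 0"
  shows "mesh2.minimiser 1 (a - 1/2, 1/2, 1/2)"
proof -
  let ?e = "mesh2.err (a - 1/2, 1/2, 1/2)"
  let ?\<phi> = "three_hats hex_norm hex_norm"
  have cont_e: "continuous_on UNIV ?e"
    using mesh2.continuous_on_err[of UNIV "\<lambda>z. z"] by simp
  note [measurable] = borel_measurable_continuous_onI[OF cont_e]
  have err:
    "z \<in> lower_triangle 0 0 \<Longrightarrow> ?e z < 0"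
    "z \<in> upper_triangle 0 0 \<Longrightarrow> ?e z = 0"
    "z \<in> lower_triangle (1/2) 0 \<Longrightarrow> ?e z = 1 - a * (2 * (1 - fst z))"
    "z \<in> upper_triangle (1/2) 0 \<Longrightarrow> ?e z = 2 * fst z - 1 - (a - 1) * (1 - 2 * snd z)"
    "z \<in> lower_triangle 0 (1/2) \<Longrightarrow> ?e z = 0"
    "z \<in> upper_triangle 0 (1/2) \<Longrightarrow> ?e z = 0"
    "z \<in> lower_triangle (1/2) (1/2) \<Longrightarrow> 0 < ?e z"
    "z \<in> upper_triangle (1/2) (1/2) \<Longrightarrow> 0 < ?e z" for z
  proof -
    show "?e z < 0" if z: "z \<in> lower_triangle 0 0"
    proof -
      have "?e z = - (2 * (a - 1) * (fst z - snd z))"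
        unfolding mesh2.err_def hex_hats_on_triangles(1)[OF z] by (simp add: algebra_simps)
      also have "\<dots> < 0" using a z by (simp add: lower_triangle_def)
      finally show ?thesis .
    qed
    show "?e z = 0" if z: "z \<in> upper_triangle 0 0"
      unfolding mesh2.err_def hex_hats_on_triangles(2)[OF z] by simp
    show "?e z = 1 - a * (2 * (1 - fst z))" if z: "z \<in> lower_triangle (1/2) 0"
      unfolding mesh2.err_def hex_hats_on_triangles(3)[OF z] by (simp add: algebra_simps)
    show "?e z = 2 * fst z - 1 - (a - 1) * (1 - 2 * snd z)" if z: "z \<in> upper_triangle (1/2) 0"
      unfolding mesh2.err_def hex_hats_on_triangles(4)[OF z] by (simp add: field_simps)
    show "?e z = 0" if z: "z \<in> lower_triangle 0 (1/2)"
      unfolding mesh2.err_def hex_hats_on_triangles(5)[OF z] by (simp add: field_simps)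
    show "?e z = 0" if z: "z \<in> upper_triangle 0 (1/2)"
      unfolding mesh2.err_def hex_hats_on_triangles(6)[OF z] by simp
    show "0 < ?e z" if z: "z \<in> lower_triangle (1/2) (1/2)"
      unfolding mesh2.err_def hex_hats_on_triangles(7)[OF z]
      using z by (simp add: lower_triangle_def)
    show "0 < ?e z" if z: "z \<in> upper_triangle (1/2) (1/2)"
      unfolding mesh2.err_def hex_hats_on_triangles(8)[OF z]
      using z by (simp add: upper_triangle_def field_simps)
  qed

  \<comment> \<open>The contribution to the hat at \<open>(1/2, 1/2)\<close> of the triangle on which the error changes sign; it
      enters only through the bound \<open>\<bar>Y\<bar> \<le> 1/24\<close>.\<close>
  define Y where "Y = (LINT z:upper_triangle (1/2) 0|lborel. sgn (?e z) * (1 + 2 * snd z - 2 * fst z))"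
  define r where "r = - 24 * Y"
  have abs_Y: "\<bar>Y\<bar> \<le> 1 / 24"
  proof -
    let ?h = "\<lambda>z :: real \<times> real. 1 + 2 * snd z - 2 * fst z"
    have h: "continuous_on UNIV ?h" by (intro continuous_intros)
    have sub: "upper_triangle (1/2) 0 \<subseteq> unit_square" by (simp add: triangles_subset_unit_square)
    have nonneg: "0 \<le> ?h z" if "z \<in> upper_triangle (1/2) 0" for z
      using that by (simp add: upper_triangle_def)
    have int_h: "set_integrable lborel (upper_triangle (1/2) 0) ?h"
      using sub h by (intro set_integrable_continuous_square) auto
    have int_minus_h: "set_integrable lborel (upper_triangle (1/2) 0) (\<lambda>z. - ?h z)"
      using sub h by (intro set_integrable_continuous_square continuous_on_minus) auto
    have val_minus: "(LINT z:upper_triangle (1/2) 0|lborel. - ?h z) = - (1 / 24)"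
      using integral_eq_affine_upper[of "1/2" 0 "\<lambda>z. - ?h z" 0 2 "-2"] by simp
    have val: "(LINT z:upper_triangle (1/2) 0|lborel. ?h z) = 1 / 24"
      using integral_eq_affine_upper[of "1/2" 0 ?h 0 "-2" 2] by simp
    have int: "set_integrable lborel (upper_triangle (1/2) 0) (\<lambda>z. sgn (?e z) * ?h z)"
    proof (rule set_integrable_bounded_square[OF _ sub, where B = 1])
      show "(\<lambda>z. sgn (?e z) * ?h z) \<in> borel_measurable borel"
        using borel_measurable_continuous_onI[OF h] by measurable
      show "\<bar>sgn (?e z) * ?h z\<bar> \<le> 1" if "z \<in> upper_triangle (1/2) 0" for z
        using that by (auto simp: abs_mult sgn_if upper_triangle_def)
    qed simp
    have aux: "sgn x * h \<le> h" "- h \<le> sgn x * h" if "0 \<le> h" for x h :: real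
      using that by (auto simp: sgn_if)
    have "Y \<le> 1 / 24"
      unfolding Y_def val[symmetric]
      by (intro set_integral_mono int int_h aux nonneg)
    moreover have "(LINT z:upper_triangle (1/2) 0|lborel. - ?h z) \<le> Y"
      unfolding Y_def
      by (intro set_integral_mono int int_minus_h aux nonneg)
    ultimately show ?thesis
      using val_minus by (simp add: abs_le_iff)
  qed
  then have abs_r: "\<bar>r\<bar> \<le> 1" by (simp add: r_def abs_mult)

  define w where "w z = sgn (?e z) - indicat_real (lower_triangle 0 (1/2)) z
      + r * indicat_real (upper_triangle 0 0) z" for z
  have w_meas [measurable]: "w \<in> borel_measurable borel" unfolding w_def[abs_def] by measurable
  have w_bound: "\<bar>w z\<bar> \<le> 3" for z
    using abs_r by (auto simp: w_def sgn_if indicator_def)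

  have orth: "(LINT z:open_unit_square|lborel. w z * ?\<phi> d z) = 0" for d
  proof -
    obtain d0 d1 d2 where d: "d = (d0, d1, d2)" by (cases d)
    obtain C where C: "\<And>z. z \<in> unit_square \<Longrightarrow> \<bar>?\<phi> d z\<bar> \<le> C"
      using bounded_on_unit_square[OF mesh2.continuous_shape] by blast
    have [measurable]: "?\<phi> d \<in> borel_measurable borel"
      by (rule borel_measurable_continuous_onI[OF mesh2.continuous_shape])
    have meas: "(\<lambda>z. w z * ?\<phi> d z) \<in> borel_measurable borel" by measurable
    have bound: "\<bar>w z * ?\<phi> d z\<bar> \<le> 3 * C" if "z \<in> unit_square" for z
      unfolding abs_mult using C[OF that] w_bound[of z] by (intro mult_mono) auto
    note triangles = lower_triangle_def upper_triangle_def

    \<comment> \<open>The triangles are numbered as in \<open>integral_square_triangles\<close>, with the two on which the error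
      changes sign at the end.\<close>
    have t1: "(LINT z:lower_triangle 0 0|lborel. w z * ?\<phi> d z) = - d0 / 24 - d1 / 24"
    proof -
      have "w z * ?\<phi> d z = 0 + (- 2 * d0) * (fst z - 0) + (2 * d0 - 2 * d1) * (snd z - 0)"
        if z: "z \<in> lower_triangle 0 0" for z
      proof -
        have "w z = -1" using z err(1)[OF z] by (auto simp: w_def indicator_def triangles)
        then show ?thesis unfolding hex_hats_on_triangles(1)[OF z] by (simp add: d algebra_simps)
      qed
      from integral_eq_affine_lower[OF _ _ this] show ?thesis by (simp add: field_simps)
    qed
    have t2: "(LINT z:upper_triangle 0 0|lborel. w z * ?\<phi> d z) = r * d1 / 24"
    proof -
      have "w z * ?\<phi> d z = 0 + (2 * r * d1) * (fst z - 0) + 0 * (snd z - 0)"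
        if z: "z \<in> upper_triangle 0 0" for z
      proof -
        have "w z = r" using z err(2)[OF z] by (auto simp: w_def indicator_def triangles)
        then show ?thesis unfolding hex_hats_on_triangles(2)[OF z] by (simp add: d)
      qed
      from integral_eq_affine_upper[OF _ _ this] show ?thesis by simp
    qed
    have t5: "(LINT z:lower_triangle 0 (1/2)|lborel. w z * ?\<phi> d z) = - d1 / 24 - d2 / 24"
    proof -
      have "w z * ?\<phi> d z = 0 + (- 2 * d1) * (fst z - 0) + (2 * d1 - 2 * d2) * (snd z - 1/2)"
        if z: "z \<in> lower_triangle 0 (1/2)" for z
      proof -
        have "w z = -1" using z err(5)[OF z] by (auto simp: w_def indicator_def triangles)
        then show ?thesis unfolding hex_hats_on_triangles(5)[OF z] by (simp add: d algebra_simps)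
      qed
      from integral_eq_affine_lower[OF _ _ this] show ?thesis by (simp add: field_simps)
    qed
    have t6: "(LINT z:upper_triangle 0 (1/2)|lborel. w z * ?\<phi> d z) = 0"
    proof -
      have "w z * ?\<phi> d z = 0 + 0 * (fst z - 0) + 0 * (snd z - 1/2)"
        if z: "z \<in> upper_triangle 0 (1/2)" for z
        using z err(6)[OF z] by (auto simp: w_def indicator_def triangles)
      from integral_eq_affine_upper[OF _ _ this] show ?thesis by simp
    qed
    have t7: "(LINT z:lower_triangle (1/2) (1/2)|lborel. w z * ?\<phi> d z) = d1 / 24"
    proof -
      have "w z * ?\<phi> d z = d1 + (- 2 * d1) * (fst z - 1/2) + 0 * (snd z - 1/2)"
        if z: "z \<in> lower_triangle (1/2) (1/2)" for z
      proof -
        have "w z = 1" using z err(7)[OF z] by (auto simp: w_def indicator_def triangles)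
        then show ?thesis unfolding hex_hats_on_triangles(7)[OF z] by (simp add: d algebra_simps)
      qed
      from integral_eq_affine_lower[OF _ _ this] show ?thesis by (simp add: field_simps)
    qed
    have t8: "(LINT z:upper_triangle (1/2) (1/2)|lborel. w z * ?\<phi> d z) = d1 / 24 + d2 / 24"
    proof -
      have "w z * ?\<phi> d z = d1 + (- 2 * d2) * (fst z - 1/2) + (2 * d2 - 2 * d1) * (snd z - 1/2)"
        if z: "z \<in> upper_triangle (1/2) (1/2)" for z
      proof -
        have "w z = 1" using z err(8)[OF z] by (auto simp: w_def indicator_def triangles)
        then show ?thesis unfolding hex_hats_on_triangles(8)[OF z] by (simp add: d algebra_simps)
      qed
      from integral_eq_affine_upper[OF _ _ this] show ?thesis by (simp add: field_simps)
    qed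
    define b where "b = a - 1"
    define K1 where "K1 = ((b + (1 - b) / 2 - 1/3) - (b\<^sup>2 - (1 - b) * b\<^sup>2 / 2 - b^3 / 3)) / a^3"
    define K2 where "K2 = (1/2 - 1/3 + (b\<^sup>2 / 2 + b^3 / 3)) / a\<^sup>2 - b / 3"
    have K: "K1 + K2 = 1 / 6"
      using mesh2_orthogonality_algebra[OF a root] by (simp add: K1_def K2_def b_def)
    have has_K1: "((\<lambda>t. sgn (1 - a * t) * (t * (1 - t))) has_integral K1) {0..1}"
      using integral_pow_deriv_parabola[OF order_refl a] a
      by (simp add: K1_def b_def pow_deriv_1 add_ac)
    have has_K2: "((\<lambda>s. s * (\<bar>1 - a * s\<bar> - \<bar>b * s\<bar>)) has_integral K2) {0..1}"
      using integral_bottom_slices[OF order_refl a] a by (simp add: K2_def b_def add_ac)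

    have t3: "(LINT z:lower_triangle (1/2) 0|lborel. w z * ?\<phi> d z) = d0 * K1 / 4"
    proof -
      let ?g = "\<lambda>x. sgn (1 - a * (2 * (1/2 + 1/2 - x))) * (2 * (1/2 + 1/2 - x) * (1 - 2 * (1/2 + 1/2 - x)))"
      have w: "w z * ?\<phi> d z = sgn (1 - a * (2 * (1 - fst z))) * (2 * d0 * (1 - fst z))"
        if z: "z \<in> lower_triangle (1/2) 0" for z
      proof -
        have "w z = sgn (1 - a * (2 * (1 - fst z)))"
          using z err(3)[OF z] by (auto simp: w_def indicator_def triangles)
        then show ?thesis unfolding hex_hats_on_triangles(3)[OF z] by (simp add: d)
      qed
      have "(LINT z:lower_triangle (1/2) 0|lborel. w z * ?\<phi> d z) =
          (LINT z:lower_triangle (1/2) 0|lborel. sgn (1 - a * (2 * (1 - fst z))) * (2 * d0 * (1 - fst z)))"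
        using w by (intro set_lebesgue_integral_cong) auto
      also have "\<dots> = d0 / 2 * (K1 / 2)"
      proof (rule integral_vertical_slices[OF _ _ _ lower_triangle_def, where B = "\<bar>2 * d0\<bar>"])
        have "(\<lambda>z :: real \<times> real. 1 - a * (2 * (1 - fst z))) \<in> borel_measurable borel"
          "(\<lambda>z :: real \<times> real. 2 * d0 * (1 - fst z)) \<in> borel_measurable borel"
          by (intro borel_measurable_continuous_onI continuous_intros)+
        then show "(\<lambda>z :: real \<times> real. sgn (1 - a * (2 * (1 - fst z))) * (2 * d0 * (1 - fst z))) \<in> borel_measurable borel"
          by measurable
        show "lower_triangle (1/2) 0 \<subseteq> unit_square" by (simp add: triangles_subset_unit_square)
        show "\<bar>sgn (1 - a * (2 * (1 - fst z))) * (2 * d0 * (1 - fst z))\<bar> \<le> \<bar>2 * d0\<bar>"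
          if "z \<in> lower_triangle (1/2) 0" for z
        proof -
          have "\<bar>sgn (1 - a * (2 * (1 - fst z)))\<bar> * (\<bar>2 * d0\<bar> * \<bar>1 - fst z\<bar>) \<le> 1 * (\<bar>2 * d0\<bar> * 1)"
            using that by (intro mult_mono) (auto simp: sgn_if triangles)
          then show ?thesis by (simp add: abs_mult)
        qed
        show "((\<lambda>y :: real. sgn (1 - a * (2 * (1 - fst (x, y)))) * (2 * d0 * (1 - fst (x, y)))) has_integral
            d0 / 2 * ?g x) {0..0 + (x - 1/2)}" if "1/2 < x" for x
          using has_integral_const_real[of "sgn (1 - a * (2 * (1 - x))) * (2 * d0 * (1 - x))" 0 "x - 1/2"] that
          by (simp add: algebra_simps)
        show "((\<lambda>x. d0 / 2 * ?g x) has_integral d0 / 2 * (K1 / 2)) {1/2..1/2 + 1/2}"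
          by (rule has_integral_mult_right[OF has_integral_half_interval(2)[OF has_K1]])
      qed simp_all
      finally show ?thesis by simp
    qed

    have t4: "(LINT z:upper_triangle (1/2) 0|lborel. w z * ?\<phi> d z) = d0 * K2 / 4 + d1 * Y"
    proof -
      let ?f0 = "\<lambda>z :: real \<times> real. sgn (2 * fst z - 1 - b * (1 - 2 * snd z)) * (1 - 2 * snd z)"
      let ?f1 = "\<lambda>z. sgn (?e z) * (1 + 2 * snd z - 2 * fst z)"
      have sub: "upper_triangle (1/2) 0 \<subseteq> unit_square" by (simp add: triangles_subset_unit_square)
      have "(\<lambda>z :: real \<times> real. 2 * fst z - 1 - b * (1 - 2 * snd z)) \<in> borel_measurable borel"
        "(\<lambda>z :: real \<times> real. 1 - 2 * snd z) \<in> borel_measurable borel"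
        "(\<lambda>z :: real \<times> real. 1 + 2 * snd z - 2 * fst z) \<in> borel_measurable borel"
        by (intro borel_measurable_continuous_onI continuous_intros)+
      note [measurable] = this
      have meas0: "?f0 \<in> borel_measurable borel" and meas1: "?f1 \<in> borel_measurable borel" by measurable
      have bound0: "\<bar>?f0 z\<bar> \<le> 1" and bound1: "\<bar>?f1 z\<bar> \<le> 1" if "z \<in> upper_triangle (1/2) 0" for z
        using that by (auto simp: abs_mult sgn_if triangles)
      have int0: "set_integrable lborel (upper_triangle (1/2) 0) ?f0"
        by (rule set_integrable_bounded_square[OF _ sub meas0 bound0]) simp_all
      have int1: "set_integrable lborel (upper_triangle (1/2) 0) ?f1"
        by (rule set_integrable_bounded_square[OF _ sub meas1 bound1]) simp_all
      have w: "w z * ?\<phi> d z = d0 * ?f0 z + d1 * ?f1 z" if z: "z \<in> upper_triangle (1/2) 0" for z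
      proof -
        have w: "w z = sgn (?e z)" and e: "?e z = 2 * fst z - 1 - b * (1 - 2 * snd z)"
          using z err(4)[OF z] by (auto simp: w_def indicator_def triangles b_def)
        show ?thesis unfolding hex_hats_on_triangles(4)[OF z] w e by (simp add: d algebra_simps)
      qed
      have "(LINT z:upper_triangle (1/2) 0|lborel. w z * ?\<phi> d z) =
          (LINT z:upper_triangle (1/2) 0|lborel. d0 * ?f0 z + d1 * ?f1 z)"
        using w by (intro set_lebesgue_integral_cong) auto
      also have "\<dots> = d0 * (LINT z:upper_triangle (1/2) 0|lborel. ?f0 z) + d1 * Y"
        unfolding Y_def using int0 int1 by (simp add: set_integral_add(2) set_integral_mult_right)
      also have "(LINT z:upper_triangle (1/2) 0|lborel. ?f0 z) = K2 / 2 / 2"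
      proof (rule integral_horizontal_slices[OF meas0, where l = "\<lambda>_. 1/2" and u = "\<lambda>y. y + 1/2" and a = 0 and b = "1/2"])
        show "upper_triangle (1/2) 0 = {z. 0 < snd z \<and> snd z < 1/2 \<and> 1/2 < fst z \<and> fst z < snd z + 1/2}"
          by (auto simp: triangles)
        let ?G = "\<lambda>s. s * (\<bar>1 - a * s\<bar> - \<bar>b * s\<bar>)"
        show "((\<lambda>x. ?f0 (x, y)) has_integral ?G (2 * (0 + 1/2 - y)) / 2) {1/2..y + 1/2}" if "0 < y" for y
        proof -
          let ?s = "2 * (0 + 1/2 - y)"
          have ends: "2 * (y + 1/2) - (1 + b * ?s) = 1 - a * ?s" "2 * (1/2) - (1 + b * ?s) = - (b * ?s)"
            by (simp_all add: b_def field_simps)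
          have "1/2 \<le> y + 1/2" using that by simp
          from has_integral_mult_left[OF has_integral_pow_deriv[OF order_refl _ this, of 2 "1 + b * ?s"], of ?s]
          have "((\<lambda>x. sgn (2 * x - (1 + b * ?s)) * ?s) has_integral ?G ?s / 2) {1/2..y + 1/2}"
            unfolding ends by (simp add: pow_deriv_1 mult.commute)
          then show ?thesis by (simp add: algebra_simps)
        qed
        show "((\<lambda>y. ?G (2 * (0 + 1/2 - y)) / 2) has_integral K2 / 2 / 2) {0..1/2}"
          using has_integral_divide[OF has_integral_half_interval(2)[OF has_K2, of 0], of 2] by simp
      qed (use sub bound0 in auto)
      finally show ?thesis by simp
    qed
    have "(LINT z:open_unit_square|lborel. w z * ?\<phi> d z) =
        - d0 / 24 - d1 / 24 + (r * d1 / 24 + (d0 * K1 / 4 + (d0 * K2 / 4 + d1 * Y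
        + (- d1 / 24 - d2 / 24 + (0 + (d1 / 24 + (d1 / 24 + d2 / 24)))))))"
      by (subst integral_square_triangles[OF meas bound])
        (simp_all only: list.map sum_list.Cons sum_list.Nil add_0_right t1 t2 t3 t4 t5 t6 t7 t8)
    also have "\<dots> = d0 / 4 * (K1 + K2 - 1 / 6)" by (simp add: r_def field_simps)
    finally show ?thesis by (simp add: K)
  qed

  show ?thesis
  proof (rule mesh2.minimiser_if_orthogonal[OF order_refl w_meas w_bound _ orth])
    fix z :: "real \<times> real" and y :: real
    have tri: "?e z = 0 \<and> w z = -1" if "z \<in> lower_triangle 0 (1/2)"
      using that err(5)[OF that] by (auto simp: w_def indicator_def lower_triangle_def upper_triangle_def)
    have tri': "?e z = 0 \<and> w z = r" if "z \<in> upper_triangle 0 0"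
      using that err(2)[OF that] by (auto simp: w_def indicator_def lower_triangle_def upper_triangle_def)
    have "w z = sgn (?e z)" if "z \<notin> lower_triangle 0 (1/2)" "z \<notin> upper_triangle 0 0"
      using that by (simp add: w_def)
    moreover have "r * y \<le> \<bar>y\<bar>"
    proof -
      have "\<bar>r\<bar> * \<bar>y\<bar> \<le> 1 * \<bar>y\<bar>" using abs_r by (intro mult_right_mono) auto
      then show ?thesis using abs_ge_self[of "r * y"] by (simp add: abs_mult)
    qed
    ultimately show "\<bar>?e z\<bar> powr 1 + 1 * w z * (y - ?e z) \<le> \<bar>y\<bar> powr 1"
      using abs_powr_ge_tangent[of 1 "?e z" y] tri tri'
      by (cases "z \<in> lower_triangle 0 (1/2)"; cases "z \<in> upper_triangle 0 0")
        (auto simp: pow_deriv_1)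
  qed
qed

text \<open>Otherwise the values \<open>(1, 1, 1)\<close> and \<open>(a, 1, 1)\<close> would both be optimal, although close to the
  node \<open>(1/2, 0)\<close>, on its right, the first has a positive error and the second a negative one.\<close>

lemma mesh2_ridge_not_minimiser:
  fixes a :: real
  assumes a: "1 < a" and root: "3 * a^3 - 8 * a + 4 = 0"
  shows "\<not> mesh2.minimiser 1 (1/2, 1/2, 1/2)"
proof
  assume min: "mesh2.minimiser 1 (1/2, 1/2, 1/2)"
  \<comment> \<open>The midpoint between \<open>1/2\<close> and the zero \<open>1 - 1 / (2 a)\<close> of the error of \<open>(a, 1, 1)\<close>.\<close>
  define x where "x = 3 / 4 - 1 / (4 * a)"
  define z where "z = (x, (x - 1/2) / 2)"
  have x: "1/2 < x" "x < 1" using a by (simp_all add: x_def field_simps)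
  have z: "z \<in> lower_triangle (1/2) 0" using x by (simp add: z_def lower_triangle_def)
  have err: "mesh2.err (s, 1/2, 1/2) z = x - 2 * s * (1 - x)" for s
    unfolding mesh2.err_def hex_hats_on_triangles(3)[OF z] by (simp add: z_def)
  have "x - 2 * (a - 1/2) * (1 - x) = (1 - a) / 2" using a by (simp add: x_def field_simps)
  moreover have "0 \<le> mesh2.err (1/2, 1/2, 1/2) z * mesh2.err (a - 1/2, 1/2, 1/2) z"
    using z triangles_subset_unit_square(1)[of "1/2" 0]
    by (intro mesh2.minimisers_same_sign min mesh2_minimiser[OF a root]) auto
  ultimately show False using a x unfolding err by (simp add: zero_le_mult_iff)
qed

section \<open>The over- and undershoot theorem\<close>

theorem theorem1p5:
  fixes u :: "real \<times> real \<Rightarrow> real"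
  assumes "\<And>z. z \<in> open_unit_square \<Longrightarrow> u z = 1"
  shows
    "((\<exists>\<alpha>::real. \<alpha> > 1 \<and> 0 = 2 * \<alpha>^3 - 5 * \<alpha> + 2) \<and>
      (\<forall>\<alpha>::real. \<alpha> > 1 \<and> 0 = 2 * \<alpha>^3 - 5 * \<alpha> + 2 \<longrightarrow>
         \<bar>\<alpha> - 1.3200\<bar> \<le> 0.00005 \<and>
         (\<exists>v. solutions u mesh1 1 = {v} \<and> v (1/2, 1/2) = \<alpha>)))
     \<and>
     (\<forall>q::real. q > 1 \<longrightarrow>
      (\<exists>\<alpha>::real. \<alpha> > 1 \<and>
         0 = (\<alpha> - 1) powr (q - 1) * (4 * \<alpha>^3 * q + 4 * (1 - q) * \<alpha>^2 + (q - 6) * \<alpha> + 2)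
               - \<alpha> * (q + 4) + 2) \<and>
      (\<forall>\<alpha>::real. \<alpha> > 1 \<and>
         0 = (\<alpha> - 1) powr (q - 1) * (4 * \<alpha>^3 * q + 4 * (1 - q) * \<alpha>^2 + (q - 6) * \<alpha> + 2)
               - \<alpha> * (q + 4) + 2 \<longrightarrow>
         (\<exists>v. solutions u mesh1 q = {v} \<and> v (1/2, 1/2) = \<alpha>)))
     \<and>
     (\<forall>q::real. q > 1 \<longrightarrow> (\<forall>M\<in>{mesh1, mesh2, mesh3, mesh4}.
         \<exists>v. solutions u M q = {v} \<and> over_or_undershoots M v))
     \<and>
     ((\<exists>\<alpha>::real. \<alpha> > 1 \<and> 0 = - 3 * \<alpha>^3 + 8 * \<alpha> - 4) \<and>
      (\<forall>\<alpha>::real. \<alpha> > 1 \<and> 0 = - 3 * \<alpha>^3 + 8 * \<alpha> - 4 \<longrightarrow>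
         \<bar>\<alpha> - 1.2723\<bar> \<le> 0.00005 \<and>
         (\<exists>v\<in>solutions u mesh2 1. v (1/2, 1) = 1 \<and> v (1/2, 1/2) = 1 \<and> v (1/2, 0) = \<alpha>)) \<and>
      (\<exists>v. {w \<in> admissible mesh2. w (1/2, 1) = 1 \<and> w (1/2, 1/2) = 1 \<and> w (1/2, 0) = 1} = {v} \<and>
         v \<notin> solutions u mesh2 1))
     \<and>
     (\<forall>M\<in>{mesh3, mesh4}. \<exists>v\<in>solutions u M 1.
         v (1/2, 1) = 1 \<and> v (1/2, 1/2) = 1 \<and> v (1/2, 0) = 1)"
proof -
  have u: "\<forall>z\<in>open_unit_square. u z = 1" using assms by blast
  have over1: "\<exists>v. solutions u mesh1 q = {v} \<and> over_or_undershoots mesh1 v" if q: "1 < q" for q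
  proof -
    obtain a where a: "1 < a" "overshoot_residual q a = 0" using overshoot_residual_root[OF q] by blast
    then obtain v where "solutions u mesh1 q = {v}" "v (1/2, 1/2) = a"
      using mesh1_solutions[OF u less_imp_le[OF q] a] by blast
    then show ?thesis using a by (auto simp: over_or_undershoots_def free_nodes_mesh1)
  qed

  have part1: "\<exists>a>1. 0 = 2 * a^3 - 5 * a + (2 :: real)"
  proof -
    have "\<exists>a\<ge>1. a \<le> 2 \<and> 2 * a^3 - 5 * a + 2 = (0 :: real)"
      by (rule IVT') (auto intro!: continuous_intros)
    then obtain a :: real where a: "1 \<le> a" "2 * a^3 - 5 * a + 2 = 0" by blast
    then have "a \<noteq> 1" by auto
    with a show ?thesis by (intro exI[of _ a]) auto
  qed
  have part4: "\<exists>a>1. 0 = - 3 * a^3 + 8 * a - (4 :: real)"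
  proof -
    have "\<exists>a\<ge>1. a \<le> 2 \<and> 3 * a^3 - 8 * a + 4 = (0 :: real)"
      by (rule IVT') (auto intro!: continuous_intros)
    then obtain a :: real where a: "1 \<le> a" "3 * a^3 - 8 * a + 4 = 0" by blast
    then have "a \<noteq> 1" by auto
    with a show ?thesis by (intro exI[of _ a]) auto
  qed

  have sol1: "\<bar>a - 1.3200\<bar> \<le> 0.00005 \<and> (\<exists>v. solutions u mesh1 1 = {v} \<and> v (1/2, 1/2) = a)"
    if a: "1 < a" "0 = 2 * a^3 - 5 * a + 2" for a :: real
  proof
    show "\<bar>a - 1.3200\<bar> \<le> 0.00005"
    proof -
      have "1.31995 < a" "a < 1.32005"
        using cubic_root_bounds[of 2 5 a 2 "1.31995" "1.32005"] a by (simp_all add: power3_eq_cube)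
      then show ?thesis by (auto simp: abs_if)
    qed
    show "\<exists>v. solutions u mesh1 1 = {v} \<and> v (1/2, 1/2) = a"
      using a overshoot_residual_1[OF a(1)] by (intro mesh1_solutions[OF u]) auto
  qed
  have sol2: "\<exists>v. solutions u mesh1 q = {v} \<and> v (1/2, 1/2) = a"
    if "1 < q" "1 < a" "overshoot_residual q a = 0" for q a
    using that by (intro mesh1_solutions[OF u]) auto

  have sol4: "\<bar>a - 1.2723\<bar> \<le> 0.00005 \<and>
      (\<exists>v\<in>solutions u mesh2 1. v (1/2, 1) = 1 \<and> v (1/2, 1/2) = 1 \<and> v (1/2, 0) = a)"
    if a: "1 < a" "0 = - 3 * a^3 + 8 * a - 4" for a :: real
  proof
    have root: "3 * a^3 - 8 * a + 4 = 0" using a(2) by simp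
    show "\<bar>a - 1.2723\<bar> \<le> 0.00005"
    proof -
      have "1.27225 < a" "a < 1.27235"
        using cubic_root_bounds[of 3 8 a 4 "1.27225" "1.27235"] a(1) root by (simp_all add: power3_eq_cube)
      then show ?thesis by (auto simp: abs_if)
    qed
    have "mesh2.trial (a - 1/2, 1/2, 1/2) \<in> solutions u mesh2 1"
      using mesh2_minimiser[OF a(1) root] by (simp add: mesh2.solutions_eq[OF u])
    then show "\<exists>v\<in>solutions u mesh2 1. v (1/2, 1) = 1 \<and> v (1/2, 1/2) = 1 \<and> v (1/2, 0) = a"
      by (rule bexI[rotated]) (simp add: mesh2.trial_nodes)
  qed
  have not4: "\<exists>v. {w \<in> admissible mesh2. w (1/2, 1) = 1 \<and> w (1/2, 1/2) = 1 \<and> w (1/2, 0) = 1} = {v} \<and>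
      v \<notin> solutions u mesh2 1"
  proof (intro exI conjI)
    show "{w \<in> admissible mesh2. w (1/2, 1) = 1 \<and> w (1/2, 1/2) = 1 \<and> w (1/2, 0) = 1} = {mesh2.trial (1/2, 1/2, 1/2)}"
    proof -
      have "p = (1/2, 1/2, 1/2)"
        if "mesh2.trial p (1/2, 1) = 1" "mesh2.trial p (1/2, 1/2) = 1" "mesh2.trial p (1/2, 0) = 1" for p
        using that by (cases p) (simp add: mesh2.trial_nodes)
      moreover have "mesh2.trial (1/2, 1/2, 1/2) (1/2, 1) = 1" "mesh2.trial (1/2, 1/2, 1/2) (1/2, 1/2) = 1"
        "mesh2.trial (1/2, 1/2, 1/2) (1/2, 0) = 1"
        by (simp_all add: mesh2.trial_nodes)
      ultimately show ?thesis unfolding mesh2.admissible_eq by blast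
    qed
    obtain a :: real where "1 < a" "3 * a^3 - 8 * a + 4 = 0" using part4 by auto
    then have "\<not> mesh2.minimiser 1 (1/2, 1/2, 1/2)" by (rule mesh2_ridge_not_minimiser)
    then show "mesh2.trial (1/2, 1/2, 1/2) \<notin> solutions u mesh2 1"
      unfolding mesh2.solutions_eq[OF u order_refl] using mesh2.inj_trial by blast
  qed

  have sol5: "\<exists>v\<in>solutions u M 1. v (1/2, 1) = 1 \<and> v (1/2, 1/2) = 1 \<and> v (1/2, 0) = 1"
    if "M \<in> {mesh3, mesh4}" for M
  proof -
    have "\<exists>v\<in>solutions u mesh3 1. v (1/2, 1) = 1 \<and> v (1/2, 1/2) = 1 \<and> v (1/2, 0) = 1"
    proof (intro bexI conjI)
      have "mesh3.minimiser 1 (1/2, 1/2, 1/2)"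
        by (rule mesh3.ridge_minimiser_if_symmetric) (simp_all add: sum_norm_def max_norm_def)
      then show "mesh3.trial (1/2, 1/2, 1/2) \<in> solutions u mesh3 1" by (simp add: mesh3.solutions_eq[OF u])
    qed (simp_all add: mesh3.trial_nodes)
    moreover have "\<exists>v\<in>solutions u mesh4 1. v (1/2, 1) = 1 \<and> v (1/2, 1/2) = 1 \<and> v (1/2, 0) = 1"
    proof (intro bexI conjI)
      have "mesh4.minimiser 1 (1/2, 1/2, 1/2)"
        by (rule mesh4.ridge_minimiser_if_symmetric) (simp_all add: sum_norm_def max_norm_def)
      then show "mesh4.trial (1/2, 1/2, 1/2) \<in> solutions u mesh4 1" by (simp add: mesh4.solutions_eq[OF u])
    qed (simp_all add: mesh4.trial_nodes)
    ultimately show ?thesis using that by blast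
  qed

  have sol3: "\<exists>v. solutions u M q = {v} \<and> over_or_undershoots M v"
    if "1 < q" "M \<in> {mesh1, mesh2, mesh3, mesh4}" for q M
    using that over1 mesh2.unique_solution_overshoots[OF u] mesh3.unique_solution_overshoots[OF u]
      mesh4.unique_solution_overshoots[OF u] by blast

  have root2: "\<exists>a>1. 0 = (a - 1) powr (q - 1) * (4 * a^3 * q + 4 * (1 - q) * a^2 + (q - 6) * a + 2) - a * (q + 4) + 2"
    if "1 < q" for q :: real
    using overshoot_residual_root[OF that] unfolding overshoot_residual_def by metis
  have sol2': "\<exists>v. solutions u mesh1 q = {v} \<and> v (1/2, 1/2) = a"
    if "1 < q" "1 < a \<and> 0 = (a - 1) powr (q - 1) * (4 * a^3 * q + 4 * (1 - q) * a^2 + (q - 6) * a + 2) - a * (q + 4) + 2"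
    for q a :: real
    using sol2[of q a] that unfolding overshoot_residual_def by metis
  show ?thesis
    by (intro conjI allI impI ballI part1 part4 sol1 root2 sol2' sol3 sol4 not4 sol5; (elim conjE)?; assumption)
qed

end
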